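(* Let $R\in(0,\infty)$, let $N\ge2$ and $k\ge1$ be integers and $p$ real. Let $\phi$ be a nonnegative smooth function on $[0,R)$, positive on $(0,R)$, with $\phi'(0)=1$ and $\phi^{(i)}(0)=0$ for all even $i\ge0$, and assume that $$0<\liminf_{r\to R}\phi(r)\le\limsup_{r\to R}\phi(r)<\infty.$$ If $N=kp$ and $p>1$, then there exists a constant $C>0$ such that for all $v\in W^{k,p}((0,R),\phi^{N-1})$, $$|v(t)|\le C\left[\left(\log\frac{R}{t}\right)^{\frac{p-1}{p}}+1\right]\|v\|_{W^{k,p}_{\phi^{N-1}}},\qquad\forall t\in(0,R].$$
   Context: $W^{k,p}((0,R),\phi^{N-1})$ is the space of $v\colon(0,R)\to\mathbb R$ having $k$ weak derivatives with $\int_0^R|v^{(j)}(t)|^p\phi^{N-1}(t)\,\mathrm dt<\infty$ for all $j=0,\ldots,k$, with norm $\|v\|_{W^{k,p}_{\phi^{N-1}}}=\big(\sum_{j=0}^k\int_0^R|v^{(j)}(t)|^p\phi^{N-1}(t)\,\mathrm dt\big)^{1/p}$. Each $v$ in this space is identified with its representative that is continuous on $(0,R]$. *)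

theory Defs
  imports "HOL-Analysis.Analysis"
begin

text \<open>Derivatives are taken within \<^term>\<open>S\<close>, so that they are one-sided at a boundary point
  such as 0 in \<^term>\<open>{0..<R}\<close>.\<close>

primrec nth_deriv_within :: "nat \<Rightarrow> (real \<Rightarrow> real) \<Rightarrow> real set \<Rightarrow> real \<Rightarrow> real" where
  "nth_deriv_within 0 f S = f"
| "nth_deriv_within (Suc i) f S =
     (\<lambda>t. vector_derivative (nth_deriv_within i f S) (at t within S))"

definition smooth_on :: "real set \<Rightarrow> (real \<Rightarrow> real) \<Rightarrow> bool" where
  "smooth_on S f \<longleftrightarrow> (\<forall>i. \<forall>t\<in>S. nth_deriv_within i f S differentiable (at t within S))"

definition test_function :: "real set \<Rightarrow> (real \<Rightarrow> real) \<Rightarrow> bool" where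
  "test_function \<Omega> \<psi> \<longleftrightarrow>
     smooth_on UNIV \<psi> \<and> compact (closure {x. \<psi> x \<noteq> 0}) \<and> closure {x. \<psi> x \<noteq> 0} \<subseteq> \<Omega>"

definition locally_integrable_on :: "(real \<Rightarrow> real) \<Rightarrow> real set \<Rightarrow> bool" where
  "locally_integrable_on f \<Omega> \<longleftrightarrow>
     (\<forall>K. compact K \<longrightarrow> K \<subseteq> \<Omega> \<longrightarrow> set_integrable lebesgue K f)"

text \<open>The values of \<^term>\<open>v\<close> and \<^term>\<open>w\<close> outside the open set \<^term>\<open>\<Omega>\<close> are irrelevant.\<close>

definition has_weak_deriv ::
    "real set \<Rightarrow> nat \<Rightarrow> (real \<Rightarrow> real) \<Rightarrow> (real \<Rightarrow> real) \<Rightarrow> bool" where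
  "has_weak_deriv \<Omega> j v w \<longleftrightarrow>
     locally_integrable_on v \<Omega> \<and> locally_integrable_on w \<Omega> \<and>
     (\<forall>\<psi>. test_function \<Omega> \<psi> \<longrightarrow>
        (LINT t:\<Omega>|lebesgue. v t * nth_deriv_within j \<psi> UNIV t) =
        (-1) ^ j * (LINT t:\<Omega>|lebesgue. w t * \<psi> t))"

text \<open>A weak derivative is determined only up to a null set; the choice made here does not
  affect integrals over \<^term>\<open>\<Omega>\<close>.\<close>

definition weak_deriv :: "real set \<Rightarrow> nat \<Rightarrow> (real \<Rightarrow> real) \<Rightarrow> real \<Rightarrow> real" where
  "weak_deriv \<Omega> j v = (if j = 0 then v else (SOME w. has_weak_deriv \<Omega> j v w))"

definition weighted_sobolev ::
    "real set \<Rightarrow> nat \<Rightarrow> real \<Rightarrow> (real \<Rightarrow> real) \<Rightarrow> (real \<Rightarrow> real) set" where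
  "weighted_sobolev \<Omega> k p \<omega> =
     {v. \<forall>j\<le>k. (\<exists>w. has_weak_deriv \<Omega> j v w) \<and>
           set_integrable lebesgue \<Omega> (\<lambda>t. \<bar>weak_deriv \<Omega> j v t\<bar> powr p * \<omega> t)}"

definition weighted_sobolev_norm ::
    "real set \<Rightarrow> nat \<Rightarrow> real \<Rightarrow> (real \<Rightarrow> real) \<Rightarrow> (real \<Rightarrow> real) \<Rightarrow> real" where
  "weighted_sobolev_norm \<Omega> k p \<omega> v =
     (\<Sum>j=0..k. LINT t:\<Omega>|lebesgue. \<bar>weak_deriv \<Omega> j v t\<bar> powr p * \<omega> t) powr (1 / p)"

text \<open>Such a \<^term>\<open>u\<close> is unique on \<^term>\<open>{0<..R}\<close>; its value at \<^term>\<open>R\<close> is the limit from the left.\<close>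

definition continuous_representative ::
    "real \<Rightarrow> (real \<Rightarrow> real) \<Rightarrow> (real \<Rightarrow> real) \<Rightarrow> bool" where
  "continuous_representative R v u \<longleftrightarrow>
     continuous_on {0<..R} u \<and> (AE t in lebesgue. t \<in> {0<..<R} \<longrightarrow> u t = v t)"

end

theory Submission
  imports Defs
begin

text \<open>Since \<^term>\<open>\<phi> t\<close> is bounded below by a multiple of \<^term>\<open>t\<close>, the weight may be replaced by
  \<^term>\<open>t ^ (N - 1)\<close>. Near \<^term>\<open>R\<close> the weight is bounded below, so every weak derivative of order below
  \<^term>\<open>k\<close> has a continuous representative whose value at \<^term>\<open>R\<close> is controlled by the norm, and it is
  bounded at \<^term>\<open>t\<close> by a constant plus the integral of the next derivative over \<^term>\<open>{t<..<R}\<close>. Iterating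
  this and exchanging the order of integration as in Taylor's formula bounds \<^term>\<open>v t\<close> by a constant plus
  the integral of \<^term>\<open>s ^ (k - 1)\<close> times the modulus of the \<^term>\<open>k\<close>-th derivative over \<^term>\<open>{t<..<R}\<close>.
  Because \<^term>\<open>N = k * p\<close>, Hoelder's inequality leaves the dual factor equal to the integral of
  \<^term>\<open>1 / s\<close>, which is \<^term>\<open>ln (R / t)\<close>.\<close>

subsection \<open>Smooth functions with compact support\<close>

text \<open>The derivative is an existential witness rather than an iterated
  \<open>vector_derivative\<close>, so closure under sums, products and affine substitutions follows
  by induction on the order.\<close>

primrec times_differentiable :: "nat \<Rightarrow> (real \<Rightarrow> real) \<Rightarrow> bool" where
  "times_differentiable 0 f \<longleftrightarrow> True"
| "times_differentiable (Suc n) f \<longleftrightarrow>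
     (\<exists>f'. (\<forall>x. (f has_real_derivative f' x) (at x)) \<and> times_differentiable n f')"

lemma times_differentiable_const [simp]: "times_differentiable n (\<lambda>x. c)"
proof (induction n arbitrary: c)
  case (Suc n)
  then show ?case by (auto intro!: exI[of _ "\<lambda>x. 0"])
qed simp

lemma times_differentiable_SucD: "times_differentiable (Suc n) f \<Longrightarrow> times_differentiable n f"
  by (induction n arbitrary: f) fastforce+

lemma times_differentiable_add:
  "times_differentiable n f \<Longrightarrow> times_differentiable n g \<Longrightarrow> times_differentiable n (\<lambda>x. f x + g x)"
proof (induction n arbitrary: f g)
  case (Suc n)
  then obtain f' g' where "\<And>x. (f has_real_derivative f' x) (at x)" "times_differentiable n f'"
    "\<And>x. (g has_real_derivative g' x) (at x)" "times_differentiable n g'" by auto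
  with Suc.IH show ?case by (auto intro!: exI[of _ "\<lambda>x. f' x + g' x"] derivative_intros)
qed simp

lemma times_differentiable_mult:
  "times_differentiable n f \<Longrightarrow> times_differentiable n g \<Longrightarrow> times_differentiable n (\<lambda>x. f x * g x)"
proof (induction n arbitrary: f g)
  case (Suc n)
  then obtain f' g' where d: "\<And>x. (f has_real_derivative f' x) (at x)" "times_differentiable n f'"
    "\<And>x. (g has_real_derivative g' x) (at x)" "times_differentiable n g'" by auto
  have "times_differentiable n f" "times_differentiable n g"
    using Suc.prems times_differentiable_SucD by blast+
  then have "times_differentiable n (\<lambda>x. f' x * g x + g' x * f x)"
    using Suc.IH d by (intro times_differentiable_add) auto
  then show ?case using d by (auto intro!: exI[of _ "\<lambda>x. f' x * g x + g' x * f x"] derivative_eq_intros)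
qed simp

lemma times_differentiable_affine:
  "times_differentiable n f \<Longrightarrow> times_differentiable n (\<lambda>x. f (a * x + b))"
proof (induction n arbitrary: f)
  case (Suc n)
  then obtain f' where d: "\<And>x. (f has_real_derivative f' x) (at x)" "times_differentiable n f'" by auto
  have "((\<lambda>x. f (a * x + b)) has_real_derivative f' (a * x + b) * a) (at x)" for x
    by (rule DERIV_chain2[OF d(1)]) (auto intro!: derivative_eq_intros)
  then show ?case using Suc.IH[OF d(2)]
    by (auto intro!: exI[of _ "\<lambda>x. f' (a * x + b) * a"] times_differentiable_mult)
qed simp

text \<open>Each differentiation spends one order. A surplus order is kept throughout, so that
  \<open>vector_derivative\<close> is a genuine derivative at every stage.\<close>

lemma times_differentiable_nth_deriv_within:
  "times_differentiable (Suc (i + n)) f \<Longrightarrow> times_differentiable (Suc n) (nth_deriv_within i f UNIV)"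
proof (induction i arbitrary: n)
  case (Suc i)
  then have "times_differentiable (Suc (Suc n)) (nth_deriv_within i f UNIV)"
    using Suc.IH[of "Suc n"] by (simp del: times_differentiable.simps)
  then obtain f' where d: "\<And>x. (nth_deriv_within i f UNIV has_real_derivative f' x) (at x)"
    "times_differentiable (Suc n) f'" by auto
  then have "nth_deriv_within (Suc i) f UNIV = f'"
    by (auto simp: fun_eq_iff has_real_derivative_iff_has_vector_derivative
        intro!: vector_derivative_at)
  with d show ?case by simp
qed simp

lemma smooth_on_UNIV_I:
  assumes "\<And>n. times_differentiable n f"
  shows "smooth_on UNIV f"
  unfolding smooth_on_def
proof (intro allI ballI)
  fix i t
  have "times_differentiable (Suc 0) (nth_deriv_within i f UNIV)"
    using times_differentiable_nth_deriv_within[of i 0 f] assms by blast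
  then show "nth_deriv_within i f UNIV differentiable at t"
    by (auto simp: real_differentiable_def)
qed

section \<open>The smooth function exp(-1/x) extended by zero\<close>

definition exp_cutoff :: "nat \<Rightarrow> real \<Rightarrow> real" where
  "exp_cutoff m x = (if x \<le> 0 then 0 else inverse x ^ m * exp (- inverse x))"

lemma tendsto_exp_cutoff: "((\<lambda>x. inverse x ^ m * exp (- inverse x)) \<longlongrightarrow> (0::real)) (at_right 0)"
proof -
  have "((\<lambda>x::real. inverse x ^ m / exp (inverse x)) \<longlongrightarrow> 0) (at_right 0)"
    by (rule filterlim_compose[OF tendsto_power_div_exp_0 filterlim_inverse_at_top_right])
  then show ?thesis by (simp add: exp_minus divide_inverse)
qed

text \<open>The factors \<open>inverse x ^ m\<close> make the family closed under differentiation,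
  so one induction over the order gives smoothness of every member. At 0 the exponential decay beats
  every negative power.\<close>

lemma exp_cutoff_has_derivative:
  "(exp_cutoff m has_real_derivative - real m * exp_cutoff (Suc m) x + exp_cutoff (Suc (Suc m)) x) (at x)"
proof -
  consider "x < 0" | "x = 0" | "x > 0" by linarith
  then show ?thesis
  proof cases
    case 1
    have "((\<lambda>x. 0) has_real_derivative 0) (at x)" by simp
    then have "(exp_cutoff m has_real_derivative 0) (at x)"
      by (rule has_field_derivative_transform_within_open[of _ _ _ "{..<0}"])
        (use 1 in \<open>auto simp: exp_cutoff_def\<close>)
    with 1 show ?thesis by (simp add: exp_cutoff_def)
  next
    case 3
    have inv: "(inverse has_real_derivative - (inverse x * inverse x)) (at x)"
      using 3 DERIV_inverse[of x] by (simp add: numeral_2_eq_2)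
    have "((\<lambda>x. inverse x ^ m) has_real_derivative - real m * inverse x ^ Suc m) (at x)"
    proof (cases m)
      case (Suc j)
      show ?thesis
        using DERIV_power_Suc[OF inv, of j] by (simp add: Suc algebra_simps)
    qed simp
    moreover have "((\<lambda>x. exp (- inverse x)) has_real_derivative exp (- inverse x) * (inverse x * inverse x)) (at x)"
      using DERIV_chain2[OF DERIV_exp DERIV_minus[OF inv]] by simp
    ultimately have "((\<lambda>x. inverse x ^ m * exp (- inverse x)) has_real_derivative
       - real m * exp_cutoff (Suc m) x + exp_cutoff (Suc (Suc m)) x) (at x)"
      using 3 by (auto dest: DERIV_mult simp: exp_cutoff_def algebra_simps)
    then show ?thesis
      by (rule has_field_derivative_transform_within_open[of _ _ _ "{0<..}"])
        (use 3 in \<open>auto simp: exp_cutoff_def\<close>)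
  next
    case 2
    \<comment> \<open>From the right the difference quotient at 0 is
      \<open>exp_cutoff (Suc m)\<close>; from the left it is identically 0.\<close>
    have "((\<lambda>h. (exp_cutoff m (0 + h) - exp_cutoff m 0) / h) \<longlongrightarrow> 0) (at_right 0)"
    proof (rule Lim_transform_eventually[OF tendsto_exp_cutoff[of "Suc m"]])
      show "\<forall>\<^sub>F x in at_right 0. inverse x ^ Suc m * exp (- inverse x) =
          (exp_cutoff m (0 + x) - exp_cutoff m 0) / x"
        by (auto simp: exp_cutoff_def divide_simps eventually_at_filter)
    qed
    moreover have "((\<lambda>h. (exp_cutoff m (0 + h) - exp_cutoff m 0) / h) \<longlongrightarrow> 0) (at_left 0)"
    proof (rule Lim_transform_eventually[OF tendsto_const])
      show "\<forall>\<^sub>F x in at_left 0. 0 = (exp_cutoff m (0 + x) - exp_cutoff m 0) / x"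
        by (auto simp: exp_cutoff_def eventually_at_filter)
    qed
    ultimately show ?thesis using 2 
      by (simp add: DERIV_def filterlim_split_at exp_cutoff_def)
  qed
qed

lemma times_differentiable_exp_cutoff: "times_differentiable n (exp_cutoff m)"
proof (induction n arbitrary: m)
  case (Suc n)
  then show ?case
    using exp_cutoff_has_derivative[of m]
    by (auto intro!: exI[of _ "\<lambda>x. - real m * exp_cutoff (Suc m) x + exp_cutoff (Suc (Suc m)) x"]
        times_differentiable_add times_differentiable_mult)
qed simp

lemma exp_cutoff_0_bounds: "0 \<le> exp_cutoff 0 x" "exp_cutoff 0 x \<le> 1" "0 < x \<Longrightarrow> 0 < exp_cutoff 0 x"
  by (auto simp: exp_cutoff_def)

text \<open>For negative \<open>x\<close> the interval \<open>{0..x}\<close> is empty and the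
  integral is 0. Since \<open>f\<close> vanishes there, this is also the integral from a base point
  to the left of \<open>x\<close>, so the fundamental theorem applies on both sides of 0.\<close>

lemma has_real_derivative_integral_from_0:
  fixes f :: "real \<Rightarrow> real"
  assumes "continuous_on UNIV f" "\<And>x. x \<le> 0 \<Longrightarrow> f x = 0"
  shows "((\<lambda>x. integral {0..x} f) has_real_derivative f x) (at x)"
proof -
  define a where "a = min (x - 1) 0"
  have c: "continuous_on S f" for S using assms(1) continuous_on_subset by blast
  have "((\<lambda>x. integral {a..x} f) has_real_derivative f x) (at x within {a..x+1})"
    by (rule integral_has_real_derivative[OF c]) (auto simp: a_def)
  then have "((\<lambda>x. integral {a..x} f) has_real_derivative f x) (at x)"
    by (simp add: at_within_Icc_at a_def)
  then show ?thesis
  proof (rule has_field_derivative_transform_within_open[of _ _ _ "{a<..}"])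
    fix y assume y: "y \<in> {a<..}"
    show "integral {a..y} f = integral {0..y} f"
    proof (cases "y \<le> 0")
      case True
      then have "integral {a..y} f = integral {a..y} (\<lambda>_. 0)"
        by (intro integral_cong) (auto intro: assms)
      moreover have "integral {0..y} f = 0" using True by (cases "y = 0") auto
      ultimately show ?thesis by simp
    next
      case False
      have "integral {a..0} f + integral {0..y} f = integral {a..y} f"
        using False y by (intro Henstock_Kurzweil_Integration.integral_combine integrable_continuous_interval c) (auto simp: a_def)
      moreover have "integral {a..0} f = integral {a..0} (\<lambda>_. 0)"
        by (intro integral_cong) (auto intro: assms)
      ultimately show ?thesis by simp
    qed
  qed (auto simp: a_def)
qed

section \<open>Derivatives of test functions and weak derivatives of consecutive orders\<close>

lemma nth_deriv_within_shift:
  "nth_deriv_within (Suc j) \<psi> S = nth_deriv_within j (nth_deriv_within 1 \<psi> S) S"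
  by (induction j) auto

text \<open>Off the closed support \<open>?K\<close> the function is locally zero because the
  complement is open, so differentiation does not enlarge the support.\<close>

lemma test_function_deriv:
  assumes "test_function \<Omega> \<psi>"
  shows "test_function \<Omega> (nth_deriv_within 1 \<psi> UNIV)"
proof -
  let ?d = "nth_deriv_within 1 \<psi> UNIV" and ?K = "closure {x. \<psi> x \<noteq> 0}"
  have "?d x = 0" if "x \<notin> ?K" for x
  proof -
    have "((\<lambda>x. 0) has_real_derivative 0) (at x)" by simp
    then have "(\<psi> has_real_derivative 0) (at x)"
      by (rule has_field_derivative_transform_within_open[of _ _ _ "- ?K"])
        (use that closure_subset[of "{x. \<psi> x \<noteq> 0}"] in \<open>auto simp: open_Compl\<close>)
    then show ?thesis
      by (simp add: vector_derivative_at has_real_derivative_iff_has_vector_derivative)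
  qed
  then have "{x. ?d x \<noteq> 0} \<subseteq> ?K" by auto
  then have "closure {x. ?d x \<noteq> 0} \<subseteq> ?K" by (simp add: closure_minimal)
  moreover have "smooth_on UNIV ?d"
    using assms unfolding test_function_def smooth_on_def nth_deriv_within_shift[symmetric] by blast
  ultimately show ?thesis
    using assms unfolding test_function_def
    by (metis bounded_subset closed_closure compact_eq_bounded_closed order_trans)
qed

text \<open>The derivative of a test function is again one. Testing order \<open>j\<close> against
  it and order \<open>Suc j\<close> against the function itself expresses the same integral of
  \<open>v\<close> twice, and the sign \<open>(-1) ^ j\<close> cancels.\<close>

lemma has_weak_deriv_step:
  assumes "has_weak_deriv \<Omega> j v f" "has_weak_deriv \<Omega> (Suc j) v g"
  shows "has_weak_deriv \<Omega> 1 f g"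
  unfolding has_weak_deriv_def
proof (intro conjI allI impI)
  fix \<psi> assume \<psi>: "test_function \<Omega> \<psi>"
  have "(-1) ^ j * (LINT t:\<Omega>|lebesgue. f t * nth_deriv_within 1 \<psi> UNIV t)
      = (-1) ^ Suc j * (LINT t:\<Omega>|lebesgue. g t * \<psi> t)"
    using assms \<psi> test_function_deriv[OF \<psi>]
    unfolding has_weak_deriv_def nth_deriv_within_shift by metis
  then have "(-1) ^ j * (LINT t:\<Omega>|lebesgue. f t * nth_deriv_within 1 \<psi> UNIV t)
      = (-1) ^ j * ((-1) ^ 1 * (LINT t:\<Omega>|lebesgue. g t * \<psi> t))" by simp
  then show "(LINT t:\<Omega>|lebesgue. f t * nth_deriv_within 1 \<psi> UNIV t)
      = (-1) ^ 1 * (LINT t:\<Omega>|lebesgue. g t * \<psi> t)"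
    by (subst (asm) mult_cancel_left) auto
qed (use assms in \<open>auto simp: has_weak_deriv_def\<close>)

section \<open>Smooth bumps, steps and plateaus\<close>

definition bump :: "real \<Rightarrow> nat \<Rightarrow> real \<Rightarrow> real" where
  "bump h n x = exp_cutoff 0 (real (Suc n) * x) * exp_cutoff 0 (real (Suc n) * (h - x))"

lemma bump_bounds: "0 \<le> bump h n x" "bump h n x \<le> 1"
  using exp_cutoff_0_bounds by (auto simp: bump_def mult_le_one)

lemma bump_pos: "0 < x \<Longrightarrow> x < h \<Longrightarrow> 0 < bump h n x"
  by (auto simp: bump_def intro!: mult_pos_pos exp_cutoff_0_bounds)

lemma bump_eq_0: "x \<le> 0 \<or> h \<le> x \<Longrightarrow> bump h n x = 0"
  by (auto simp: bump_def exp_cutoff_def mult_le_0_iff)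

lemma times_differentiable_bump: "times_differentiable m (bump h n)"
proof -
  have "bump h n = (\<lambda>x. exp_cutoff 0 (real (Suc n) * x + 0) * exp_cutoff 0 ((- real (Suc n)) * x + real (Suc n) * h))"
    by (auto simp: bump_def fun_eq_iff algebra_simps)
  then show ?thesis
    by (simp only: times_differentiable_mult times_differentiable_affine times_differentiable_exp_cutoff)
qed

lemma continuous_on_bump: "continuous_on S (bump h n)"
proof -
  obtain f' where "\<And>x. (bump h n has_real_derivative f' x) (at x)"
    using times_differentiable_bump[of "Suc 0" h n] by auto
  then show ?thesis
    by (meson DERIV_isCont continuous_at_imp_continuous_on)
qed

text \<open>Stretching by \<open>Suc n\<close> sends both exponents to 0 inside the interval, while
  outside it the bump vanishes for every \<open>n\<close>.\<close>

lemma bump_tendsto: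
  assumes "0 < h"
  shows "(\<lambda>n. bump h n x) \<longlonglongrightarrow> indicator {0<..<h} x"
proof (cases "0 < x \<and> x < h")
  case True
  have "bump h n x = exp (- (inverse (real (Suc n)) * inverse x)) * exp (- (inverse (real (Suc n)) * inverse (h - x)))" for n
    using True by (simp add: bump_def exp_cutoff_def mult_le_0_iff)
  moreover have "(\<lambda>n. exp (- (inverse (real (Suc n)) * inverse x)) * exp (- (inverse (real (Suc n)) * inverse (h - x))))
      \<longlonglongrightarrow> exp (- (0 * inverse x)) * exp (- (0 * inverse (h - x)))"
    by (intro tendsto_intros LIMSEQ_inverse_real_of_nat)
  ultimately show ?thesis using True by simp
next
  case False
  then have "bump h n x = 0" for n by (intro bump_eq_0) auto
  with False show ?thesis by (auto simp: indicator_def)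
qed

lemma integral_bump_tendsto:
  assumes "0 < h"
  shows "(\<lambda>n. integral {0..h} (bump h n)) \<longlonglongrightarrow> h"
proof -
  have "(\<lambda>n. integral {0..h} (bump h n)) \<longlonglongrightarrow> integral {0..h} (indicator {0<..<h})"
  proof (rule dominated_convergence(2)[where h = "\<lambda>_. 1"])
    show "bump h n integrable_on {0..h}" for n
      by (intro integrable_continuous_interval continuous_on_bump)
  qed (use bump_bounds[of h] bump_tendsto[OF assms] in auto)
  also have "integral {0..h} (indicator {0<..<h}) = integral {0..h} (\<lambda>_. 1::real)"
    by (rule integral_spike[of "{0,h}"]) auto
  finally show ?thesis using assms by simp
qed

lemma integral_bump_pos: "0 < h \<Longrightarrow> 0 < integral {0..h} (bump h n)"
proof -
  assume h: "0 < h"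
  have "integral {0..h} (bump h n) \<noteq> 0"
  proof
    assume "integral {0..h} (bump h n) = 0"
    then have "\<And>x. x \<in> {0..h} \<Longrightarrow> bump h n x = 0"
      using integral_eq_0_iff[of 0 h "bump h n"] bump_bounds continuous_on_bump h by auto
    from this[of "h/2"] show False using bump_pos[of "h/2" h n] h by auto
  qed
  moreover have "0 \<le> integral {0..h} (bump h n)"
    by (intro integral_nonneg integrable_continuous_interval continuous_on_bump bump_bounds)
  ultimately show ?thesis by linarith
qed

text \<open>A smooth approximation, as \<open>n\<close> grows, of the ramp \<open>x / h\<close> on
  \<open>{0..h}\<close>: \<open>h\<close> fixes the width and \<open>n\<close> sharpens the
  corners.\<close>

definition smooth_step :: "real \<Rightarrow> nat \<Rightarrow> real \<Rightarrow> real" where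
  "smooth_step h n x = integral {0..x} (bump h n) / integral {0..h} (bump h n)"

lemma smooth_step_derivative:
  "(smooth_step h n has_real_derivative bump h n x / integral {0..h} (bump h n)) (at x)"
  unfolding smooth_step_def
  by (intro DERIV_cdivide has_real_derivative_integral_from_0 continuous_on_bump) (simp add: bump_eq_0)

lemma smooth_step_eq_0: "x \<le> 0 \<Longrightarrow> smooth_step h n x = 0"
  by (cases "x = 0") (auto simp: smooth_step_def)

lemma smooth_step_bounds:
  assumes "0 < h"
  shows "0 \<le> smooth_step h n x" "smooth_step h n x \<le> 1" "h \<le> x \<Longrightarrow> smooth_step h n x = 1"
proof -
  have mono: "smooth_step h n x \<le> smooth_step h n y" if "x \<le> y" for x y
    by (rule DERIV_nonneg_imp_nondecreasing[OF that])
      (use smooth_step_derivative bump_bounds integral_bump_pos[OF assms] in \<open>metis less_imp_le divide_nonneg_nonneg\<close>)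
  have 1: "smooth_step h n y = 1" if "h \<le> y" for y
  proof -
    have "integral {0..h} (bump h n) + integral {h..y} (bump h n) = integral {0..y} (bump h n)"
      using that assms
      by (intro Henstock_Kurzweil_Integration.integral_combine integrable_continuous_interval continuous_on_bump) auto
    moreover have "integral {h..y} (bump h n) = integral {h..y} (\<lambda>_. 0)"
      by (intro integral_cong) (auto simp: bump_eq_0)
    ultimately show ?thesis
      using integral_bump_pos[OF assms, of n] by (simp add: smooth_step_def)
  qed
  show "h \<le> x \<Longrightarrow> smooth_step h n x = 1" by (rule 1)
  show "smooth_step h n x \<le> 1" using 1[of "max x h"] mono[of x "max x h"] by simp
  show "0 \<le> smooth_step h n x" using smooth_step_eq_0[of "min x 0"] mono[of "min x 0" x] by simp
qed

text \<open>Its derivative is a difference of two bumps of unit mass, so testing with it compares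
  averages of a function just to the right of \<open>a\<close> and of \<open>b\<close>.\<close>

definition plateau :: "real \<Rightarrow> real \<Rightarrow> real \<Rightarrow> nat \<Rightarrow> real \<Rightarrow> real" where
  "plateau a b h n x = smooth_step h n (x - a) - smooth_step h n (x - b)"

lemma plateau_derivative:
  "(plateau a b h n has_real_derivative
     (bump h n (x - a) - bump h n (x - b)) / integral {0..h} (bump h n)) (at x)"
proof -
  have "((\<lambda>x. smooth_step h n (x - c)) has_real_derivative
      bump h n (x - c) / integral {0..h} (bump h n) * 1) (at x)" for c
    by (rule DERIV_chain2[OF smooth_step_derivative]) (auto intro!: derivative_eq_intros)
  from DERIV_diff[OF this[of a] this[of b]] show ?thesis
    by (simp add: plateau_def[abs_def] diff_divide_distrib)
qed

lemma plateau_nth_deriv: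
  "nth_deriv_within 1 (plateau a b h n) UNIV x =
     (bump h n (x - a) - bump h n (x - b)) / integral {0..h} (bump h n)"
  using plateau_derivative[of a b h n x]
  by (simp add: vector_derivative_at has_real_derivative_iff_has_vector_derivative)

lemma plateau_eq_0:
  assumes "0 < h" "a \<le> b" "x \<notin> {a..b+h}"
  shows "plateau a b h n x = 0"
  using assms smooth_step_bounds[OF assms(1), where n=n] by (auto simp: plateau_def smooth_step_eq_0)

text \<open>The two functions differ only on the ramps, and by at most 1. The bound is free of
  \<open>n\<close>, so the limit in \<open>n\<close> can be taken first, with \<open>h\<close>
  fixed.\<close>

lemma plateau_approximates_indicator:
  assumes "0 < h" "a + h \<le> b"
  shows "\<bar>plateau a b h n x - indicator {a..b} x\<bar> \<le> indicator {a..a+h} x + indicator {b..b+h} x"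
proof -
  consider "x \<le> a" | "a < x" "x < a + h" | "a + h \<le> x" "x \<le> b" | "b < x" "x < b + h" | "b + h \<le> x"
    by linarith
  then show ?thesis
    using smooth_step_bounds[OF assms(1), where n=n and x="x-a"] smooth_step_bounds[OF assms(1), where n=n and x="x-b"]
      smooth_step_eq_0[of "x-a" h n] smooth_step_eq_0[of "x-b" h n] assms
    by cases (auto simp: plateau_def indicator_def)
qed

lemma test_function_plateau:
  assumes "0 < h" "a \<le> b" "l < a" "b + h < r"
  shows "test_function {l<..<r} (plateau a b h n)"
proof -
  have "times_differentiable m (plateau a b h n)" for m
  proof (rule times_differentiable_SucD)
    have "times_differentiable m
      (\<lambda>x. inverse (integral {0..h} (bump h n)) * (bump h n (1 * x + (- a)) + (- 1) * bump h n (1 * x + (- b))))"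
      by (intro times_differentiable_mult times_differentiable_add times_differentiable_const
          times_differentiable_affine times_differentiable_bump)
    then have "times_differentiable m (\<lambda>x. (bump h n (x - a) - bump h n (x - b)) / integral {0..h} (bump h n))"
      by (simp add: divide_inverse mult.commute)
    then show "times_differentiable (Suc m) (plateau a b h n)"
      using plateau_derivative[of a b h n] by (auto intro!: exI)
  qed
  then have "smooth_on UNIV (plateau a b h n)" by (rule smooth_on_UNIV_I)
  moreover have "closure {x. plateau a b h n x \<noteq> 0} \<subseteq> {a..b+h}"
    using plateau_eq_0[OF assms(1,2)] by (intro closure_minimal closed_atLeastAtMost) blast
  moreover from this have "compact (closure {x. plateau a b h n x \<noteq> 0})"
    by (meson bounded_closed_interval bounded_subset closed_closure compact_eq_bounded_closed)
  ultimately show ?thesis using assms unfolding test_function_def by fastforce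
qed

subsection \<open>The fundamental theorem of calculus for weak derivatives\<close>

lemma locally_integrable_on_subinterval:
  assumes "locally_integrable_on f {l<..<r}" "l < a" "b < r"
  shows "set_integrable lebesgue {a..b} f"
  using assms unfolding locally_integrable_on_def
  by (elim allE[of _ "{a..b}"]) auto

text \<open>The differentiation theorem is applied to the truncations of \<open>f\<close> to a
  compact exhaustion of the interval, and the countably many exceptional null sets are
  united.\<close>

lemma locally_integrable_on_Lebesgue_points:
  fixes f :: "real \<Rightarrow> real"
  assumes f: "locally_integrable_on f {l<..<r}"
  obtains S where "negligible S"
    "\<And>x. x \<in> {l<..<r} \<Longrightarrow> x \<notin> S \<Longrightarrow> ((\<lambda>h. integral {x..x+h} f / h) \<longlongrightarrow> f x) (at_right 0)"
proof -
  define K where "K n = {l + inverse (real (Suc n)) .. r - inverse (real (Suc n))}" for n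
  define F where "F n x = (if x \<in> K n then f x else 0)" for n x
  have "F n integrable_on UNIV" for n
    unfolding F_def Henstock_Kurzweil_Integration.integrable_restrict_UNIV K_def
    by (intro set_lebesgue_integral_eq_integral(1) locally_integrable_on_subinterval[OF f]) auto
  then have "F n integrable_on cbox a b" for n a b
    using integrable_on_subcbox by blast
  then have "\<exists>S. negligible S \<and> (\<forall>x e. x \<notin> S \<longrightarrow> 0 < e \<longrightarrow>
      (\<exists>d>0. \<forall>h. 0 < h \<and> h < d \<longrightarrow> norm (integral (cbox x (x + h *\<^sub>R One)) (F n) /\<^sub>R h ^ DIM(real) - F n x) < e))" for n
    by (rule integrable_ccontinuous_explicit[of "F n"]) blast
  then obtain S where S: "\<And>n. negligible (S n)"
    "\<And>n x e. x \<notin> S n \<Longrightarrow> 0 < e \<Longrightarrow>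
      \<exists>d>0. \<forall>h. 0 < h \<and> h < d \<longrightarrow> norm (integral (cbox x (x + h *\<^sub>R One)) (F n) /\<^sub>R h ^ DIM(real) - F n x) < e"
    by metis
  show ?thesis
  proof (rule that[of "\<Union>n. S n"])
    show "negligible (\<Union>n. S n)" using S(1) by (rule negligible_Union_nat)
    fix x assume x: "x \<in> {l<..<r}" "x \<notin> (\<Union>n. S n)"
    \<comment> \<open>With this \<open>n\<close> the point \<open>x\<close> is interior to
      \<open>K n\<close>, and averages of width below \<open>d0\<close> see only untruncated
      values.\<close>
    obtain n where n: "inverse (real (Suc n)) < min (x - l) (r - x)"
      using x reals_Archimedean[of "min (x - l) (r - x)"] by auto
    define d0 where "d0 = r - inverse (real (Suc n)) - x"
    have d0: "0 < d0" using n by (simp add: d0_def)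
    have Feq: "integral {x..x+h} (F n) = integral {x..x+h} f" if "0 < h" "h < d0" for h
      using that n by (intro integral_cong) (auto simp: F_def K_def d0_def)
    have Fx: "F n x = f x" using n by (auto simp: F_def K_def)
    show "((\<lambda>h. integral {x..x+h} f / h) \<longlongrightarrow> f x) (at_right 0)"
    proof (rule tendstoI)
      fix e :: real assume "0 < e"
      with S(2)[of x n e] x obtain d where d: "d > 0"
        "\<And>h. 0 < h \<and> h < d \<Longrightarrow> norm (integral {x..x+h} (F n) / h - f x) < e"
        by (auto simp: Fx divide_inverse mult.commute)
      show "\<forall>\<^sub>F h in at_right 0. dist (integral {x..x+h} f / h) (f x) < e"
        using eventually_at_right_real[of 0 "min d d0"] d(1) d0
        by (auto elim!: eventually_mono simp: dist_norm) (metis Feq d(2) real_norm_def)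
    qed
  qed
qed

lemma tendsto_integral_shrinking:
  fixes g :: "real \<Rightarrow> real"
  assumes "g integrable_on {a..b}" "a < b"
  shows "((\<lambda>h. integral {a..a+h} g) \<longlongrightarrow> 0) (at_right 0)"
proof -
  have "continuous_on {a..b} (\<lambda>x. integral {a..x} g)"
    by (rule indefinite_integral_continuous_1[OF assms(1)])
  then have "((\<lambda>x. integral {a..x} g) \<longlongrightarrow> integral {a..a} g) (at a within {a..b})"
    using assms(2) by (intro continuous_on_def[THEN iffD1, rule_format]) auto
  then have "((\<lambda>x. integral {a..x} g) \<longlongrightarrow> 0) (at_right a)"
    using assms(2) by (simp add: at_within_Icc_at_right)
  then show ?thesis
    by (subst (asm) filterlim_at_right_to_0) (simp add: add.commute)
qed

lemma bump_measurable [measurable]: "(\<lambda>x. bump h n (x - c)) \<in> borel_measurable lebesgue"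
proof -
  have "continuous_on UNIV (\<lambda>x. bump h n (x - c))"
    by (intro continuous_on_compose2[OF continuous_on_bump[of UNIV]] continuous_intros) auto
  then show ?thesis
    by (intro measurable_completion) (simp add: borel_measurable_continuous_onI)
qed

text \<open>Testing with a function that is 1 on \<^term>\<open>{a+h..b}\<close>, 0 off \<^term>\<open>{a..b+h}\<close>, and whose derivative
  approximates the normalised indicators of \<^term>\<open>{a..a+h}\<close> and \<^term>\<open>{b..b+h}\<close>.\<close>

lemma weak_deriv_averages:
  assumes w: "has_weak_deriv {l<..<r} 1 f g" and h: "0 < h" "l < a" "a + h \<le> b" "b + h < r"
  shows "\<bar>integral {b..b+h} f / h - integral {a..a+h} f / h - integral {a..b} g\<bar>
      \<le> integral {a..a+h} (\<lambda>t. \<bar>g t\<bar>) + integral {b..b+h} (\<lambda>t. \<bar>g t\<bar>)"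
proof -
  define K where "K = {a..b+h}"
  have K: "K \<subseteq> {l<..<r}" using h by (auto simp: K_def)
  have li: "set_integrable lebesgue {c..d} f" "set_integrable lebesgue {c..d} g" if "l < c" "d < r" for c d
    using w that locally_integrable_on_subinterval by (auto simp: has_weak_deriv_def)
  \<comment> \<open>All plateaus vanish off \<open>K\<close>, so these restrictions can stand in for
    \<open>f\<close> and \<open>g\<close> and be integrated over the whole line.\<close>
  define F where "F t = indicator K t * f t" for t
  define G where "G t = indicator K t * g t" for t
  have int [simp]: "integrable lebesgue F" "integrable lebesgue G"
    using li[of a "b+h"] h by (auto simp: F_def[abs_def] G_def[abs_def] K_def set_integrable_def)
  have [measurable]: "F \<in> borel_measurable lebesgue" "G \<in> borel_measurable lebesgue"
    using int by blast+
  have sub: "(LINT t|lebesgue. F t * indicator {c..d} t) = integral {c..d} f"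
    "(LINT t|lebesgue. G t * indicator {c..d} t) = integral {c..d} g"
    "(LINT t|lebesgue. \<bar>G t\<bar> * indicator {c..d} t) = integral {c..d} (\<lambda>t. \<bar>g t\<bar>)"
    if "a \<le> c" "d \<le> b + h" for c d
  proof -
    have cd: "set_integrable lebesgue {c..d} f" "set_integrable lebesgue {c..d} g"
      using that h li[of c d] by auto
    have abs: "set_integrable lebesgue {c..d} (\<lambda>t. \<bar>g t\<bar>)"
      using cd(2) by (rule set_integrable_abs)
    show "(LINT t|lebesgue. F t * indicator {c..d} t) = integral {c..d} f"
      using that unfolding set_lebesgue_integral_eq_integral(2)[OF cd(1), symmetric] set_lebesgue_integral_def
      by (intro Bochner_Integration.integral_cong) (auto simp: F_def K_def indicator_def)
    show "(LINT t|lebesgue. G t * indicator {c..d} t) = integral {c..d} g"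
      using that unfolding set_lebesgue_integral_eq_integral(2)[OF cd(2), symmetric] set_lebesgue_integral_def
      by (intro Bochner_Integration.integral_cong) (auto simp: G_def K_def indicator_def)
    show "(LINT t|lebesgue. \<bar>G t\<bar> * indicator {c..d} t) = integral {c..d} (\<lambda>t. \<bar>g t\<bar>)"
      using that unfolding set_lebesgue_integral_eq_integral(2)[OF abs, symmetric] set_lebesgue_integral_def
      by (intro Bochner_Integration.integral_cong) (auto simp: G_def K_def indicator_def)
  qed
  have intmul: "integrable lebesgue (\<lambda>t. H t * indicator {c..d} t)" if "integrable lebesgue H" for c d and H :: "real \<Rightarrow> real"
    using integrable_real_mult_indicator[of "{c..d}" lebesgue H] that by simp
  define I where "I n = integral {0..h} (bump h n)" for n
  have I: "I n > 0" for n using integral_bump_pos[OF h(1)] by (simp add: I_def)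
  have Ilim: "I \<longlonglongrightarrow> h" using integral_bump_tendsto[OF h(1)] by (simp add: I_def[abs_def])
  \<comment> \<open>\<open>P n / I n\<close> is the integral of \<open>f\<close> against the
    derivative of the plateau with index \<open>n\<close>.\<close>
  define P where "P n = (LINT t|lebesgue. F t * (bump h n (t - a) - bump h n (t - b)))" for n
  have plat0: "plateau a b h n t = 0" if "t \<notin> K" for n t
    using plateau_eq_0[of h a b t n] that h by (auto simp: K_def)
  have bump0: "bump h n (t - a) - bump h n (t - b) = 0" if "t \<notin> K" for n t
    using that h bump_eq_0[of "t-a" h n] bump_eq_0[of "t-b" h n] by (auto simp: K_def)
  have plat_meas [measurable]: "plateau a b h n \<in> borel_measurable lebesgue" for n
  proof -
    have "continuous_on UNIV (plateau a b h n)"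
      using plateau_derivative by (meson DERIV_isCont continuous_at_imp_continuous_on)
    then show ?thesis
      by (intro measurable_completion) (simp add: borel_measurable_continuous_onI)
  qed
  \<comment> \<open>The weak derivative identity turns \<open>P n / I n\<close> into minus the
    integral of \<open>g\<close> against the plateau. Replacing the plateau by the indicator of
    \<open>{a..b}\<close> costs at most the mass of \<open>\<bar>g\<bar>\<close> on the two
    ramps.\<close>
  have bound: "\<bar>P n / I n + integral {a..b} g\<bar>
      \<le> integral {a..a+h} (\<lambda>t. \<bar>g t\<bar>) + integral {b..b+h} (\<lambda>t. \<bar>g t\<bar>)" for n
  proof -
    have t: "test_function {l<..<r} (plateau a b h n)"
      by (rule test_function_plateau) (use h in auto)
    have "(LINT t:{l<..<r}|lebesgue. f t * nth_deriv_within 1 (plateau a b h n) UNIV t) =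
        (LINT t|lebesgue. F t * (bump h n (t - a) - bump h n (t - b)) / I n)"
      unfolding set_lebesgue_integral_def plateau_nth_deriv
      using K bump0 by (intro Bochner_Integration.integral_cong) (auto simp: F_def I_def indicator_def)
    also have "\<dots> = P n / I n" by (simp add: P_def)
    finally have 1: "(LINT t:{l<..<r}|lebesgue. f t * nth_deriv_within 1 (plateau a b h n) UNIV t) = P n / I n" .
    have 2: "(LINT t:{l<..<r}|lebesgue. g t * plateau a b h n t) = (LINT t|lebesgue. G t * plateau a b h n t)"
      unfolding set_lebesgue_integral_def
      using K plat0 by (intro Bochner_Integration.integral_cong) (auto simp: G_def indicator_def)
    have gp: "integrable lebesgue (\<lambda>t. G t * plateau a b h n t)"
    proof (rule Bochner_Integration.integrable_bound[OF int(2)])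
      have "\<bar>plateau a b h n t\<bar> \<le> 1" for t
        using smooth_step_bounds(1)[OF h(1), of n "t-a"] smooth_step_bounds(1)[OF h(1), of n "t-b"]
          smooth_step_bounds(2)[OF h(1), of n "t-a"] smooth_step_bounds(2)[OF h(1), of n "t-b"]
        unfolding plateau_def by linarith
      then show "AE t in lebesgue. norm (G t * plateau a b h n t) \<le> norm (G t)"
        by (simp add: abs_mult mult_left_le)
    qed simp
    have "P n / I n = - (LINT t|lebesgue. G t * plateau a b h n t)"
      using w t 1 2 by (simp add: has_weak_deriv_def)
    then have "P n / I n + integral {a..b} g =
        - (LINT t|lebesgue. G t * plateau a b h n t - G t * indicator {a..b} t)"
      using sub(2)[of a b] h gp intmul[OF int(2)] by simp
    also have "\<bar>\<dots>\<bar> \<le> (LINT t|lebesgue. \<bar>G t * plateau a b h n t - G t * indicator {a..b} t\<bar>)"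
      by simp
    also have "\<dots> \<le> (LINT t|lebesgue. \<bar>G t\<bar> * indicator {a..a+h} t + \<bar>G t\<bar> * indicator {b..b+h} t)"
    proof (rule integral_mono)
      show "integrable lebesgue (\<lambda>t. \<bar>G t * plateau a b h n t - G t * indicator {a..b} t\<bar>)"
        using gp intmul[OF int(2)] by simp
      show "integrable lebesgue (\<lambda>t. \<bar>G t\<bar> * indicator {a..a+h} t + \<bar>G t\<bar> * indicator {b..b+h} t)"
        by (intro Bochner_Integration.integrable_add intmul integrable_abs int)
      fix t
      have "\<bar>G t * plateau a b h n t - G t * indicator {a..b} t\<bar> = \<bar>G t\<bar> * \<bar>plateau a b h n t - indicator {a..b} t\<bar>"
        by (simp add: abs_mult flip: right_diff_distrib)
      also have "\<dots> \<le> \<bar>G t\<bar> * (indicator {a..a+h} t + indicator {b..b+h} t)"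
        using plateau_approximates_indicator[OF h(1,3)] by (intro mult_left_mono) auto
      finally show "\<bar>G t * plateau a b h n t - G t * indicator {a..b} t\<bar>
          \<le> \<bar>G t\<bar> * indicator {a..a+h} t + \<bar>G t\<bar> * indicator {b..b+h} t"
        by (simp add: distrib_left)
    qed
    also have "\<dots> = integral {a..a+h} (\<lambda>t. \<bar>g t\<bar>) + integral {b..b+h} (\<lambda>t. \<bar>g t\<bar>)"
      using sub(3)[of a "a+h"] sub(3)[of b "b+h"] h intmul[OF integrable_abs[OF int(2)]] by simp
    finally show ?thesis .
  qed
  have ind_meas [measurable]: "(\<lambda>t. indicator {0<..<h} (t - c) :: real) \<in> borel_measurable lebesgue" for c
  proof -
    have "(\<lambda>t. indicator {0<..<h} (t - c) :: real) = indicator {c<..<c+h}"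
      by (auto simp: indicator_def fun_eq_iff)
    then show ?thesis by (simp add: borel_measurable_indicator measurable_completion)
  qed
  \<comment> \<open>Now \<open>n\<close> grows with \<open>h\<close> fixed: the bumps become
    indicators and \<open>I n\<close> tends to \<open>h\<close>, so \<open>P n / I n\<close> becomes
    a difference of averages.\<close>
  have "P \<longlonglongrightarrow> (LINT t|lebesgue. F t * (indicator {0<..<h} (t - a) - indicator {0<..<h} (t - b)))"
    unfolding P_def
  proof (rule integral_dominated_convergence[where w = "\<lambda>t. 2 * \<bar>F t\<bar>"])
    show "(\<lambda>t. F t * (indicator {0<..<h} (t - a) - indicator {0<..<h} (t - b))) \<in> borel_measurable lebesgue"
      by measurable
    show "AE t in lebesgue. norm (F t * (bump h n (t - a) - bump h n (t - b))) \<le> 2 * \<bar>F t\<bar>" for n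
    proof (intro AE_I2)
      fix t
      have "\<bar>bump h n (t - a) - bump h n (t - b)\<bar> \<le> 2"
        using bump_bounds[of h n "t-a"] bump_bounds[of h n "t-b"] by linarith
      then show "norm (F t * (bump h n (t - a) - bump h n (t - b))) \<le> 2 * \<bar>F t\<bar>"
        by (simp add: abs_mult mult.commute[of 2] mult_left_mono)
    qed
    show "AE t in lebesgue. (\<lambda>n. F t * (bump h n (t - a) - bump h n (t - b)))
        \<longlonglongrightarrow> F t * (indicator {0<..<h} (t - a) - indicator {0<..<h} (t - b))"
      by (intro AE_I2 tendsto_intros bump_tendsto h)
  qed auto
  also have "(LINT t|lebesgue. F t * (indicator {0<..<h} (t - a) - indicator {0<..<h} (t - b))) =
      (LINT t|lebesgue. F t * indicator {a..a+h} t - F t * indicator {b..b+h} t)"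
  proof (rule integral_cong_AE)
    have "AE t in lebesgue. t \<notin> {a,a+h,b,b+h}"
      by (rule AE_not_in) (simp add: finite_imp_null_set_lborel null_sets_completionI)
    then show "AE t in lebesgue. F t * (indicator {0<..<h} (t - a) - indicator {0<..<h} (t - b)) =
        F t * indicator {a..a+h} t - F t * indicator {b..b+h} t"
      by eventually_elim (auto simp: indicator_def)
    show "(\<lambda>t. F t * (indicator {0<..<h} (t - a) - indicator {0<..<h} (t - b))) \<in> borel_measurable lebesgue"
      by measurable
    show "(\<lambda>t. F t * indicator {a..a+h} t - F t * indicator {b..b+h} t) \<in> borel_measurable lebesgue"
      by (intro borel_measurable_integrable Bochner_Integration.integrable_diff intmul int)
  qed
  also have "\<dots> = integral {a..a+h} f - integral {b..b+h} f"
    using sub(1)[of a "a+h"] sub(1)[of b "b+h"] h intmul[OF int(1)] by simp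
  finally have "(\<lambda>n. \<bar>P n / I n + integral {a..b} g\<bar>)
      \<longlonglongrightarrow> \<bar>(integral {a..a+h} f - integral {b..b+h} f) / h + integral {a..b} g\<bar>"
    using h(1) by (intro tendsto_intros Ilim) auto
  then have "\<bar>(integral {a..a+h} f - integral {b..b+h} f) / h + integral {a..b} g\<bar>
      \<le> integral {a..a+h} (\<lambda>t. \<bar>g t\<bar>) + integral {b..b+h} (\<lambda>t. \<bar>g t\<bar>)"
    by (rule Lim_bounded[where M=0]) (use bound in auto)
  then show ?thesis by (simp add: diff_divide_distrib abs_minus_commute algebra_simps abs_diff_le_iff abs_le_iff)
qed

text \<open>As \<open>h\<close> tends to 0 in \<open>weak_deriv_averages\<close>, the averages
  converge at Lebesgue points of \<open>f\<close> and the two error integrals vanish. One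
  exceptional set serves all pairs of endpoints.\<close>

lemma weak_deriv_FTC:
  assumes w: "has_weak_deriv {l<..<r} 1 f g"
  obtains S where "negligible S"
    "\<And>a b. l < a \<Longrightarrow> a < b \<Longrightarrow> b < r \<Longrightarrow> a \<notin> S \<Longrightarrow> b \<notin> S \<Longrightarrow> f b - f a = integral {a..b} g"
proof -
  have f: "locally_integrable_on f {l<..<r}" and g: "locally_integrable_on g {l<..<r}"
    using w by (auto simp: has_weak_deriv_def)
  obtain S where S: "negligible S"
    "\<And>x. x \<in> {l<..<r} \<Longrightarrow> x \<notin> S \<Longrightarrow> ((\<lambda>h. integral {x..x+h} f / h) \<longlongrightarrow> f x) (at_right 0)"
    using locally_integrable_on_Lebesgue_points[OF f] by blast
  show ?thesis
  proof (rule that[OF S(1)])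
    fix a b assume ab: "l < a" "a < b" "b < r" "a \<notin> S" "b \<notin> S"
    have gi: "(\<lambda>t. \<bar>g t\<bar>) integrable_on {c..d}" if "l < c" "d < r" for c d
      using locally_integrable_on_subinterval[OF g that]
      by (intro set_lebesgue_integral_eq_integral(1) set_integrable_abs)
    have "\<bar>f b - f a - integral {a..b} g\<bar> \<le> 0 + 0"
    proof (rule tendsto_le[of "at_right (0::real)"])
      \<comment> \<open>The point \<open>(b+r)/2\<close> lies in the interval and to the right of
        both base points, so \<open>\<bar>g\<bar>\<close> is integrable from each of them up to
        it.\<close>
      show "((\<lambda>h. integral {a..a+h} (\<lambda>t. \<bar>g t\<bar>) + integral {b..b+h} (\<lambda>t. \<bar>g t\<bar>)) \<longlongrightarrow> 0 + 0) (at_right 0)"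
        by (intro tendsto_add tendsto_integral_shrinking[of _ _ "(b+r)/2"] gi) (use ab in auto)
      show "((\<lambda>h. \<bar>integral {b..b+h} f / h - integral {a..a+h} f / h - integral {a..b} g\<bar>)
          \<longlongrightarrow> \<bar>f b - f a - integral {a..b} g\<bar>) (at_right 0)"
        by (intro tendsto_intros S(2)) (use ab in auto)
      have "\<forall>\<^sub>F h in at_right 0. h \<in> {0<..<min (b - a) (r - b)}"
        using ab by (intro eventually_at_right_real) auto
      then show "\<forall>\<^sub>F h in at_right 0. \<bar>integral {b..b+h} f / h - integral {a..a+h} f / h - integral {a..b} g\<bar>
          \<le> integral {a..a+h} (\<lambda>t. \<bar>g t\<bar>) + integral {b..b+h} (\<lambda>t. \<bar>g t\<bar>)"
        by eventually_elim (rule weak_deriv_averages[OF w], use ab in auto)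
    qed simp
    then show "f b - f a = integral {a..b} g" by simp
  qed
qed

text \<open>The restriction to the open interval is the pointwise limit of restrictions to a compact
  exhaustion, each of which is integrable.\<close>

lemma locally_integrable_on_measurable:
  fixes f :: "real \<Rightarrow> real"
  assumes "locally_integrable_on f {l<..<r}"
  shows "(\<lambda>t. indicator {l<..<r} t * f t) \<in> borel_measurable lebesgue"
proof (rule borel_measurable_LIMSEQ_real)
  define K where "K n = {l + inverse (real (Suc n)) .. r - inverse (real (Suc n))}" for n
  show "(\<lambda>t. indicator (K n) t * f t) \<in> borel_measurable lebesgue" for n
    using locally_integrable_on_subinterval[OF assms, of "l + inverse (real (Suc n))" "r - inverse (real (Suc n))"]
    unfolding set_integrable_def K_def by (simp add: borel_measurable_integrable)
  fix t :: real
  show "(\<lambda>n. indicator (K n) t * f t) \<longlonglongrightarrow> indicator {l<..<r} t * f t"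
  proof (rule tendsto_eventually)
    show "\<forall>\<^sub>F n in sequentially. indicator (K n) t * f t = indicator {l<..<r} t * f t"
    proof (cases "t \<in> {l<..<r}")
      case True
      then have "\<forall>\<^sub>F n in sequentially. inverse (real (Suc n)) < min (t - l) (r - t)"
        by (intro order_tendstoD(2)[OF LIMSEQ_inverse_real_of_nat]) auto
      then show ?thesis by eventually_elim (use True in \<open>auto simp: K_def\<close>)
    next
      case False
      have "K n \<subseteq> {l<..<r}" for n
      proof
        fix x assume "x \<in> K n"
        moreover have "0 < inverse (real (Suc n))" by simp
        ultimately show "x \<in> {l<..<r}" unfolding K_def atLeastAtMost_iff greaterThanLessThan_iff by linarith
      qed
      with False have "t \<notin> K n" for n by blast
      then show ?thesis using False by simp
    qed
  qed
qed

subsection \<open>Tail integrals and the weight\<close>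

lemma ident_measurable_lebesgue: "(\<lambda>x. x) \<in> (lebesgue :: real measure) \<rightarrow>\<^sub>M borel"
  by (simp add: measurable_completion)

lemma sigma_finite_lebesgue: "sigma_finite_measure (lebesgue :: real measure)"
proof
  obtain A :: "real set set" where A: "countable A" "A \<subseteq> sets lborel" "\<Union>A = space lborel"
    "\<forall>a\<in>A. emeasure lborel a \<noteq> \<infinity>"
    using lborel.sigma_finite_countable by blast
  then show "\<exists>A::real set set. countable A \<and> A \<subseteq> sets lebesgue \<and> \<Union>A = space lebesgue \<and> (\<forall>a\<in>A. emeasure lebesgue a \<noteq> \<infinity>)"
    by (intro exI[of _ A]) (auto simp: subset_iff)
qed

text \<open>One step of the Taylor iteration. Tonelli's theorem exchanges the order of integration,
  and the integral of \<open>s ^ m\<close> over \<open>{t<..<r}\<close> is at most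
  \<open>r ^ m * (r - t)\<close>, hence at most \<open>r ^ Suc m\<close>.\<close>

lemma tail_integral_step:
  fixes a b :: "real \<Rightarrow> ennreal"
  assumes [measurable]: "a \<in> borel_measurable lebesgue" "b \<in> borel_measurable lebesgue"
    and ab: "AE s in lebesgue. s \<in> {0<..<R} \<longrightarrow> a s \<le> K + (\<integral>\<^sup>+r. indicator {s<..<R} r * b r \<partial>lebesgue)"
    and t: "0 < t"
  shows "(\<integral>\<^sup>+s. indicator {t<..<R} s * (ennreal (s ^ m) * a s) \<partial>lebesgue)
    \<le> K * ennreal (R ^ Suc m) + (\<integral>\<^sup>+r. indicator {t<..<R} r * (ennreal (r ^ Suc m) * b r) \<partial>lebesgue)"
proof (cases "t < R")
  case True
  interpret L: sigma_finite_measure "lebesgue :: real measure" by (rule sigma_finite_lebesgue)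
  interpret P: pair_sigma_finite "lebesgue :: real measure" "lebesgue :: real measure" ..
  note [measurable] = ident_measurable_lebesgue
  have pw: "indicator {t<..<R} s * ennreal (s ^ m) \<le> indicator {t<..<R} s * ennreal (R ^ m)" for s
    using t by (auto simp: indicator_def intro!: ennreal_leI power_mono)
  have len: "(\<integral>\<^sup>+s. indicator {t<..<R} s \<partial>lebesgue) = ennreal (R - t)"
    using True by simp
  define c where "c s r = indicator {t<..<R} s * ennreal (s ^ m) * (indicator {s<..<R} r * b r)" for s r
  have cm: "case_prod c \<in> borel_measurable (lebesgue \<Otimes>\<^sub>M lebesgue)"
  proof -
    \<comment> \<open>Writing the moving interval \<open>{s<..<R}\<close> as a comparison of the two
      coordinates exposes joint measurability.\<close>
    have "case_prod c = (\<lambda>x. indicator {t<..<R} (fst x) * ennreal (fst x ^ m) *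
        ((if fst x < snd x \<and> snd x < R then 1 else 0) * b (snd x)))"
      by (auto simp: c_def fun_eq_iff indicator_def)
    also have "\<dots> \<in> borel_measurable (lebesgue \<Otimes>\<^sub>M lebesgue)" by measurable
    finally show ?thesis .
  qed
  have "(\<integral>\<^sup>+s. indicator {t<..<R} s * (ennreal (s ^ m) * a s) \<partial>lebesgue)
      \<le> (\<integral>\<^sup>+s. K * ennreal (R ^ m) * indicator {t<..<R} s + (\<integral>\<^sup>+r. c s r \<partial>lebesgue) \<partial>lebesgue)"
  proof (rule nn_integral_mono_AE)
    show "AE s in lebesgue. indicator {t<..<R} s * (ennreal (s ^ m) * a s)
        \<le> K * ennreal (R ^ m) * indicator {t<..<R} s + (\<integral>\<^sup>+r. c s r \<partial>lebesgue)"
      using ab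
    proof eventually_elim
      case (elim s)
      show ?case
      proof (cases "s \<in> {t<..<R}")
        case s: True
        with elim t have "indicator {t<..<R} s * (ennreal (s ^ m) * a s)
           \<le> indicator {t<..<R} s * ennreal (s ^ m) * (K + (\<integral>\<^sup>+r. indicator {s<..<R} r * b r \<partial>lebesgue))"
          by (simp add: mult_left_mono)
        also have "\<dots> = indicator {t<..<R} s * ennreal (s ^ m) * K + (\<integral>\<^sup>+r. c s r \<partial>lebesgue)"
          unfolding c_def by (simp add: distrib_left nn_integral_cmult)
        also have "\<dots> \<le> indicator {t<..<R} s * ennreal (R ^ m) * K + (\<integral>\<^sup>+r. c s r \<partial>lebesgue)"
          using pw[of s] by (intro add_right_mono mult_right_mono) auto
        finally show ?thesis by (simp add: mult_ac)
      qed simp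
    qed
  qed
  also have "(\<integral>\<^sup>+s. K * ennreal (R ^ m) * indicator {t<..<R} s + (\<integral>\<^sup>+r. c s r \<partial>lebesgue) \<partial>lebesgue)
      = K * ennreal (R ^ m) * ennreal (R - t) + (\<integral>\<^sup>+s. (\<integral>\<^sup>+r. c s r \<partial>lebesgue) \<partial>lebesgue)"
    using L.borel_measurable_nn_integral[OF cm] len
    by (subst nn_integral_add) (auto simp: nn_integral_cmult)
  also have "(\<integral>\<^sup>+s. (\<integral>\<^sup>+r. c s r \<partial>lebesgue) \<partial>lebesgue) = (\<integral>\<^sup>+r. (\<integral>\<^sup>+s. c s r \<partial>lebesgue) \<partial>lebesgue)"
    using P.Fubini'[OF cm] by simp
  also have "(\<integral>\<^sup>+r. (\<integral>\<^sup>+s. c s r \<partial>lebesgue) \<partial>lebesgue)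
      \<le> (\<integral>\<^sup>+r. indicator {t<..<R} r * (ennreal (r ^ Suc m) * b r) \<partial>lebesgue)"
  proof (rule nn_integral_mono)
    fix r :: real
    show "(\<integral>\<^sup>+s. c s r \<partial>lebesgue) \<le> indicator {t<..<R} r * (ennreal (r ^ Suc m) * b r)"
    proof (cases "r \<in> {t<..<R}")
      case r: True
      have "(\<integral>\<^sup>+s. c s r \<partial>lebesgue) \<le> (\<integral>\<^sup>+s. ennreal (r ^ m) * b r * indicator {t<..<r} s \<partial>lebesgue)"
      proof (rule nn_integral_mono)
        fix s :: real
        show "c s r \<le> ennreal (r ^ m) * b r * indicator {t<..<r} s"
          using t by (auto simp: c_def indicator_def intro!: mult_right_mono ennreal_leI power_mono)
      qed
      also have "\<dots> = ennreal (r ^ m) * b r * ennreal (r - t)"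
        using r by (subst nn_integral_cmult) auto
      also have "\<dots> \<le> ennreal (r ^ m) * b r * ennreal r"
        using t by (intro mult_left_mono ennreal_leI) auto
      also have "\<dots> = ennreal (r ^ Suc m) * b r"
        using r t by (simp add: ennreal_mult mult_ac)
      finally show ?thesis using r by simp
    next
      case False
      then have "c s r = 0" for s by (auto simp: c_def indicator_def)
      then show ?thesis by simp
    qed
  qed
  also have "K * ennreal (R ^ m) * ennreal (R - t) \<le> K * ennreal (R ^ m) * ennreal R"
    using t by (intro mult_left_mono ennreal_leI) auto
  also have "\<dots> = K * ennreal (R ^ Suc m)"
    using True t by (simp add: ennreal_mult mult_ac)
  finally show ?thesis by (simp add: add_mono)
qed simp

lemma nn_integral_inverse_Ioo:
  assumes "0 < t" "t \<le> R"
  shows "(\<integral>\<^sup>+s. indicator {t<..<R} s * ennreal (1 / s) \<partial>lebesgue) = ennreal (ln (R / t))"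
proof -
  have "(\<integral>\<^sup>+s. indicator {t<..<R} s * ennreal (1 / s) \<partial>lebesgue) = (\<integral>\<^sup>+s. ennreal (1 / s) * indicator {t..R} s \<partial>lborel)"
    unfolding nn_integral_completion
  proof (rule nn_integral_cong_AE)
    have "AE s in lborel. s \<notin> {t, R}"
      by (rule AE_not_in) (simp add: finite_imp_null_set_lborel)
    then show "AE s in lborel. indicator {t<..<R} s * ennreal (1 / s) = ennreal (1 / s) * indicator {t..R} s"
      by eventually_elim (auto simp: indicator_def)
  qed
  also have "\<dots> = ennreal (ln R - ln t)"
    by (rule nn_integral_FTC_Icc) (use assms in \<open>auto intro!: derivative_eq_intros\<close>)
  finally show ?thesis using assms by (simp add: ln_div)
qed

text \<open>Near 0 the derivative 1 forces \<open>\<phi> t\<close> above \<open>t / 2\<close>, near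
  \<open>R\<close> the positive lower limit applies, and in between a positive continuous function
  has a positive minimum on a compact interval.\<close>

lemma smooth_weight_lower_bound:
  fixes \<phi> :: "real \<Rightarrow> real"
  assumes R: "0 < R" and smooth: "smooth_on {0..<R} \<phi>"
    and pos: "\<forall>r\<in>{0<..<R}. 0 < \<phi> r"
    and d: "nth_deriv_within 1 \<phi> {0..<R} 0 = 1" and "\<phi> 0 = 0"
    and lim: "0 < Liminf (at_left R) (\<lambda>r. ereal (\<phi> r))"
  obtains c where "0 < c" "\<And>t. t \<in> {0<..<R} \<Longrightarrow> c * t \<le> \<phi> t"
proof -
  have diff: "\<phi> differentiable (at t within {0..<R})" if "t \<in> {0..<R}" for t
    using smooth that by (auto simp: smooth_on_def dest: spec[of _ 0])
  have "(\<phi> has_real_derivative 1) (at 0 within {0..<R})"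
    using diff[of 0] R d vector_derivative_works[of \<phi> "at 0 within {0..<R}"]
    by (simp add: has_real_derivative_iff_has_vector_derivative)
  then have "((\<lambda>t. \<phi> t / t) \<longlongrightarrow> 1) (at 0 within {0..<R})"
    using \<open>\<phi> 0 = 0\<close> by (simp add: has_field_derivative_iff)
  then have "\<forall>\<^sub>F t in at 0 within {0..<R}. 1 / 2 < \<phi> t / t"
    by (rule order_tendstoD) simp
  then obtain e where e: "e > 0" "\<And>t. t \<in> {0..<R} \<Longrightarrow> t \<noteq> 0 \<Longrightarrow> dist t 0 < e \<Longrightarrow> 1/2 < \<phi> t / t"
    by (auto simp: eventually_at)
  obtain m where m: "0 < ereal m" "ereal m < Liminf (at_left R) (\<lambda>r. ereal (\<phi> r))"
    using ereal_dense2[OF lim] by auto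
  then have "\<forall>\<^sub>F r in at_left R. ereal m < ereal (\<phi> r)"
    using less_LiminfD by blast
  then obtain b where b: "b < R" "\<And>r. b < r \<Longrightarrow> r < R \<Longrightarrow> m < \<phi> r"
    by (auto simp: eventually_at_left_field)
  \<comment> \<open>\<open>s\<close> stays in the region governed by the derivative at 0, and
    \<open>b'\<close> lies beyond \<open>b\<close>, in the region governed by the lower
    limit.\<close>
  define s where "s = min (e / 2) (R / 2)"
  define b' where "b' = max s ((max b 0 + R) / 2)"
  have s: "0 < s" "s < R" and b': "s \<le> b'" "b' < R" using e R b by (auto simp: s_def b'_def)
  have "continuous_on {0..<R} \<phi>"
    using diff by (simp add: continuous_on_eq_continuous_within differentiable_imp_continuous_within)
  then have "continuous_on {s..b'} \<phi>"
    by (rule continuous_on_subset) (use s b' in auto)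
  then obtain x where x: "x \<in> {s..b'}" "\<And>y. y \<in> {s..b'} \<Longrightarrow> \<phi> x \<le> \<phi> y"
    using continuous_attains_inf[of "{s..b'}" \<phi>] b' by auto
  have px: "0 < \<phi> x" using x(1) s b' pos by auto
  \<comment> \<open>Dividing by \<open>R\<close> works because \<open>t < R\<close>: then
    \<open>c * t\<close> is below both \<open>m\<close> and the minimum
    \<open>\<phi> x\<close>.\<close>
  define c where "c = min (1/2) (min (m / R) (\<phi> x / R))"
  show ?thesis
  proof (rule that[of c])
    show "0 < c" using m R px by (simp add: c_def)
    fix t assume t: "t \<in> {0<..<R}"
    have ct: "c * t \<le> m" "c * t \<le> \<phi> x"
    proof -
      have "c * t \<le> c * R" using t \<open>0 < c\<close> by (intro mult_left_mono) auto
      moreover have "c * R \<le> m" "c * R \<le> \<phi> x" using R by (auto simp: c_def min_def field_simps)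
      ultimately show "c * t \<le> m" "c * t \<le> \<phi> x" by linarith+
    qed
    consider "t \<le> s" | "t \<in> {s..b'}" | "b' < t" using t by fastforce
    then show "c * t \<le> \<phi> t"
    proof cases
      case 1
      then have "1/2 < \<phi> t / t" using e t by (intro e(2)) (auto simp: s_def dist_norm)
      then have "1/2 * t < \<phi> t" using t by (simp add: field_simps)
      moreover have "c \<le> 1/2" unfolding c_def by (rule min.cobounded1)
      then have "c * t \<le> 1/2 * t" using t by (intro mult_right_mono) auto
      ultimately show ?thesis by linarith
    next
      case 2
      then show ?thesis using x(2) ct by fastforce
    next
      case 3
      have "b < b'" using b R by (auto simp: b'_def max_def)
      then show ?thesis using b(2)[of t] 3 t ct by auto
    qed
  qed
qed

text \<open>\<open>weak_deriv_FTC\<close> ties every good point to one fixed good base point, and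
  additivity of the integral moves the base point to \<open>R\<close>. Thus \<open>U\<close> is the
  value of the representative at \<open>R\<close>.\<close>

lemma weak_deriv_representative:
  assumes R: "0 < R" and w: "has_weak_deriv {0<..<R} 1 f g"
    and G: "\<And>t. t \<in> {0<..<R} \<Longrightarrow> G t = g t"
    and int: "\<And>s. 0 < s \<Longrightarrow> G integrable_on {s..R}"
  obtains U where "AE t in lebesgue. t \<in> {0<..<R} \<longrightarrow> f t = U - integral {t..R} G"
proof -
  obtain S where S: "negligible S"
    "\<And>a b. 0 < a \<Longrightarrow> a < b \<Longrightarrow> b < R \<Longrightarrow> a \<notin> S \<Longrightarrow> b \<notin> S \<Longrightarrow> f b - f a = integral {a..b} g"
    using weak_deriv_FTC[OF w] by blast
  have "\<not> negligible {0<..<R}"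
    using R open_not_negligible[of "{0<..<R}"] by (auto simp: greaterThanLessThan_empty_iff)
  then obtain a where a: "a \<in> {0<..<R}" "a \<notin> S"
    using negligible_subset[OF S(1), of "{0<..<R}"] by blast
  have comb: "integral {x..R} G = integral {x..y} g + integral {y..R} G" if "0 < x" "x \<le> y" "y < R" for x y
  proof -
    have "integral {x..y} G + integral {y..R} G = integral {x..R} G"
      using that int[of x] by (intro Henstock_Kurzweil_Integration.integral_combine) auto
    moreover have "integral {x..y} G = integral {x..y} g"
      using that by (intro integral_cong G) auto
    ultimately show ?thesis by simp
  qed
  have "f t = f a + integral {a..R} G - integral {t..R} G" if t: "t \<in> {0<..<R}" "t \<notin> S" for t
  proof -
    consider "t < a" | "t = a" | "a < t" by linarith
    then show ?thesis
      by cases (use a t S(2)[of a t] S(2)[of t a] comb[of a t] comb[of t a] in auto)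
  qed
  moreover have "AE t in lebesgue. t \<notin> S"
    using S(1) by (intro AE_not_in) (simp add: negligible_iff_null_sets)
  ultimately show ?thesis
    by (intro that[of "f a + integral {a..R} G"]) (auto elim!: AE_mp)
qed

text \<open>Subadditivity of a concave power: \<open>x / (x + 1)\<close> and
  \<open>1 / (x + 1)\<close> lie between 0 and 1, so each is at most its power with exponent
  \<open>a\<close>, and they sum to 1.\<close>

lemma powr_add_one_le:
  fixes x a :: real
  assumes "0 \<le> x" "0 \<le> a" "a \<le> 1"
  shows "(x + 1) powr a \<le> x powr a + 1"
proof -
  have le: "z / (x + 1) \<le> (z / (x + 1)) powr a" if "0 \<le> z" "z \<le> x + 1" for z
    using powr_mono'[of a 1 "z / (x + 1)"] that assms by (cases "z = 0") auto
  have "1 = x / (x + 1) + 1 / (x + 1)" using assms by (simp add: field_simps)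
  also have "\<dots> \<le> (x / (x + 1)) powr a + (1 / (x + 1)) powr a"
    using assms by (intro add_mono le) auto
  also have "\<dots> = (x powr a + 1) / (x + 1) powr a"
    using assms by (simp add: powr_divide add_divide_distrib)
  finally show ?thesis using assms by (simp add: field_simps)
qed

subsection \<open>Pointwise bounds for chains of weak derivatives\<close>

text \<open>\<open>w j\<close> plays the weak derivative of order \<open>j\<close>, \<open>M\<close>
  a bound for the Sobolev norm, and \<open>D\<close> the loss from replacing the weight by a power
  of \<open>t\<close>. \<open>M\<close> is strictly positive so that one can divide by it.\<close>

locale weak_deriv_chain =
  fixes R p D M :: real and N k :: nat and w :: "nat \<Rightarrow> real \<Rightarrow> real"
  assumes R: "0 < R" and p: "1 < p" and k: "1 \<le> k" and N: "1 \<le> N" and Nkp: "real N = real k * p"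
    and D: "0 < D" and M: "0 < M"
    and deriv: "\<And>j. j < k \<Longrightarrow> has_weak_deriv {0<..<R} 1 (w j) (w (Suc j))"
    and energy: "\<And>j. j \<le> k \<Longrightarrow>
      (\<integral>\<^sup>+t. indicator {0<..<R} t * ennreal (\<bar>w j t\<bar> powr p * t ^ (N - 1)) \<partial>lebesgue) \<le> ennreal (D * M powr p)"
begin

text \<open>Extension by zero gives a function measurable on the whole line, whereas
  \<open>w j\<close> is arbitrary outside the interval.\<close>

definition G :: "nat \<Rightarrow> real \<Rightarrow> real" where "G j t = indicator {0<..<R} t * w j t"

definition tail :: "nat \<Rightarrow> real \<Rightarrow> ennreal" where
  "tail j s = (\<integral>\<^sup>+t. indicator {s<..<R} t * ennreal \<bar>G j t\<bar> \<partial>lebesgue)"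

definition A :: "real \<Rightarrow> real" where "A s = R + D / s ^ (N - 1)"

text \<open>The factor bounding the value at \<open>R\<close>; it comes from averaging over the
  right half of the interval, of length \<open>R / 2\<close>.\<close>

definition B :: real where "B = A (R / 2) * (2 / R + 1)"

lemma A_pos: "0 < s \<Longrightarrow> 0 < A s"
  using R D by (simp add: A_def add_pos_pos)

lemma B_pos: "0 < B"
  using R A_pos[of "R/2"] by (simp add: B_def add_pos_pos)

lemma G_measurable: "j \<le> k \<Longrightarrow> G j \<in> borel_measurable lebesgue"
proof -
  assume "j \<le> k"
  have "locally_integrable_on (w j) {0<..<R}"
  proof (cases j)
    case 0
    then show ?thesis using deriv[of 0] k by (auto simp: has_weak_deriv_def)
  next
    case (Suc i)
    then show ?thesis using deriv[of i] \<open>j \<le> k\<close> by (auto simp: has_weak_deriv_def)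
  qed
  from locally_integrable_on_measurable[OF this] show ?thesis by (simp add: G_def[abs_def])
qed

lemma tail_mono: "s \<le> t \<Longrightarrow> tail j t \<le> tail j s"
  unfolding tail_def by (intro nn_integral_mono) (auto simp: indicator_def)

text \<open>With \<open>x = \<bar>G j t\<bar> / M\<close>, either \<open>x \<le> 1\<close> or
  \<open>x \<le> x powr p\<close>, which takes the place of Hoelder's inequality; on
  \<open>{s<..<R}\<close> the weight is at least \<open>s ^ (N - 1)\<close>. The two cases yield the
  two summands of \<open>A s\<close>.\<close>

lemma tail_bound:
  assumes j: "j \<le> k" and s: "0 < s"
  shows "tail j s \<le> ennreal (M * A s)"
proof (cases "s < R")
  case True
  define c where "c = M / (M powr p * s ^ (N - 1))"
  have c: "0 < c" using M s by (simp add: c_def)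
  note [measurable] = G_measurable[OF j] ident_measurable_lebesgue
  have "tail j s \<le> (\<integral>\<^sup>+t. ennreal M * indicator {s<..<R} t +
      ennreal c * (indicator {0<..<R} t * ennreal (\<bar>G j t\<bar> powr p * t ^ (N - 1))) \<partial>lebesgue)"
    unfolding tail_def
  proof (rule nn_integral_mono)
    fix t :: real
    show "indicator {s<..<R} t * ennreal \<bar>G j t\<bar> \<le> ennreal M * indicator {s<..<R} t +
      ennreal c * (indicator {0<..<R} t * ennreal (\<bar>G j t\<bar> powr p * t ^ (N - 1)))"
    proof (cases "t \<in> {s<..<R}")
      case t: True
      have "\<bar>G j t\<bar> \<le> M + c * (\<bar>G j t\<bar> powr p * t ^ (N - 1))"
      proof (cases "\<bar>G j t\<bar> \<le> M")
        case True
        then show ?thesis using c t s by (simp add: add_increasing2)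
      next
        case False
        define x where "x = \<bar>G j t\<bar> / M"
        have x: "1 \<le> x" using False M by (simp add: x_def)
        have "s ^ (N - 1) \<le> t ^ (N - 1)" using t s by (intro power_mono) auto
        then have "x powr p * 1 \<le> x powr p * (t ^ (N - 1) / s ^ (N - 1))"
          using s by (intro mult_left_mono) (auto simp: field_simps)
        moreover have "x \<le> x powr p" using powr_mono[of 1 p x] p x by simp
        ultimately have "M * x \<le> M * (x powr p * (t ^ (N - 1) / s ^ (N - 1)))"
          using M by (intro mult_left_mono) auto
        also have "\<dots> = c * (\<bar>G j t\<bar> powr p * t ^ (N - 1))"
          using M by (simp add: x_def c_def powr_divide)
        finally show ?thesis using M by (simp add: x_def)
      qed
      then have "ennreal \<bar>G j t\<bar> \<le> ennreal M + ennreal c * ennreal (\<bar>G j t\<bar> powr p * t ^ (N - 1))"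
        using M c t s by (simp add: ennreal_leI flip: ennreal_plus ennreal_mult)
      then show ?thesis using t s by simp
    qed simp
  qed
  also have "\<dots> = ennreal M * ennreal (R - s) +
      ennreal c * (\<integral>\<^sup>+t. indicator {0<..<R} t * ennreal (\<bar>G j t\<bar> powr p * t ^ (N - 1)) \<partial>lebesgue)"
    using True by (subst nn_integral_add) (auto simp: nn_integral_cmult)
  also have "(\<integral>\<^sup>+t. indicator {0<..<R} t * ennreal (\<bar>G j t\<bar> powr p * t ^ (N - 1)) \<partial>lebesgue) =
      (\<integral>\<^sup>+t. indicator {0<..<R} t * ennreal (\<bar>w j t\<bar> powr p * t ^ (N - 1)) \<partial>lebesgue)"
    by (intro nn_integral_cong) (auto simp: G_def indicator_def)
  also have "ennreal M * ennreal (R - s) + ennreal c * \<dots> \<le> ennreal M * ennreal R + ennreal c * ennreal (D * M powr p)"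
    using s by (intro add_mono mult_left_mono energy[OF j] ennreal_leI) auto
  also have "\<dots> = ennreal (M * A s)"
    using M R D c s by (simp add: A_def c_def distrib_left flip: ennreal_plus ennreal_mult)
  finally show ?thesis .
next
  case False
  then show ?thesis by (simp add: tail_def)
qed

lemma set_integrable_G:
  assumes j: "j \<le> k" and s: "0 < s"
  shows "set_integrable lebesgue {s..R} (G j)"
  unfolding set_integrable_def
proof (rule integrableI_bounded)
  note [measurable] = G_measurable[OF j]
  show "(\<lambda>t. indicator {s..R} t *\<^sub>R G j t) \<in> borel_measurable lebesgue"
    by (intro borel_measurable_scaleR borel_measurable_indicator) auto
  \<comment> \<open>\<open>tail\<close> integrates over an open interval; starting at
    \<open>s / 2\<close> covers the endpoint \<open>s\<close>.\<close>
  have "(\<integral>\<^sup>+t. ennreal (norm (indicator {s..R} t *\<^sub>R G j t)) \<partial>lebesgue) \<le> tail j (s / 2)"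
    unfolding tail_def using s by (intro nn_integral_mono) (auto simp: G_def indicator_def)
  also have "\<dots> \<le> ennreal (M * A (s / 2))" using s by (intro tail_bound j) auto
  finally show "(\<integral>\<^sup>+t. ennreal (norm (indicator {s..R} t *\<^sub>R G j t)) \<partial>lebesgue) < \<infinity>"
    by (rule le_less_trans) simp
qed

lemma integral_G_bound:
  assumes j: "j \<le> k" and s: "0 < s"
  shows "ennreal \<bar>integral {s..R} (G j)\<bar> \<le> tail j s"
proof -
  note int = set_integrable_G[OF assms]
  have "ennreal \<bar>integral {s..R} (G j)\<bar> = ennreal (norm (LINT t|lebesgue. indicator {s..R} t *\<^sub>R G j t))"
    by (simp add: set_lebesgue_integral_eq_integral(2)[OF int, symmetric] set_lebesgue_integral_def)
  also have "\<dots> \<le> (\<integral>\<^sup>+t. ennreal (norm (indicator {s..R} t *\<^sub>R G j t)) \<partial>lebesgue)"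
    using int unfolding set_integrable_def by (rule integral_norm_bound_ennreal)
  also have "\<dots> \<le> tail j s"
    unfolding tail_def
  proof (rule nn_integral_mono_AE)
    have "AE t in lebesgue. t \<notin> {s}"
      by (rule AE_not_in) (simp add: finite_imp_null_set_lborel null_sets_completionI)
    then show "AE t in lebesgue. ennreal (norm (indicator {s..R} t *\<^sub>R G j t)) \<le> indicator {s<..<R} t * ennreal \<bar>G j t\<bar>"
      by eventually_elim (auto simp: G_def indicator_def)
  qed
  finally show ?thesis .
qed

text \<open>For almost every \<open>t\<close>, \<open>U\<close> is the sum of \<open>w j t\<close>
  and a tail integral. Integrating over \<open>{R/2<..<R}\<close> bounds both through tails at
  \<open>R / 2\<close>, and dividing by the length gives \<open>B * M\<close>.\<close>

lemma constant_bound: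
  assumes j: "j < k" and U: "AE t in lebesgue. t \<in> {0<..<R} \<longrightarrow> w j t = U - integral {t..R} (G (Suc j))"
  shows "\<bar>U\<bar> \<le> B * M"
proof -
  define h where "h = R / 2"
  have h: "0 < h" "h < R" and hR: "R - h = h" using R by (auto simp: h_def)
  have [measurable]: "G j \<in> borel_measurable lebesgue" using G_measurable j by simp
  have meas: "(\<lambda>t. indicator {h<..<R} t * ennreal \<bar>G j t\<bar>) \<in> borel_measurable lebesgue"
    "(\<lambda>t. tail (Suc j) h * indicator {h<..<R} t) \<in> borel_measurable lebesgue"
    by (intro borel_measurable_times_ennreal borel_measurable_indicator measurable_compose[OF _ measurable_ennreal]
        borel_measurable_abs borel_measurable_const; simp)+
  have "ennreal \<bar>U\<bar> * ennreal h = (\<integral>\<^sup>+t. ennreal \<bar>U\<bar> * indicator {h<..<R} t \<partial>lebesgue)"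
    using h by (subst nn_integral_cmult_indicator) (auto simp: hR)
  also have "\<dots> \<le> (\<integral>\<^sup>+t. indicator {h<..<R} t * ennreal \<bar>G j t\<bar> + tail (Suc j) h * indicator {h<..<R} t \<partial>lebesgue)"
  proof (rule nn_integral_mono_AE)
    show "AE t in lebesgue. ennreal \<bar>U\<bar> * indicator {h<..<R} t \<le>
        indicator {h<..<R} t * ennreal \<bar>G j t\<bar> + tail (Suc j) h * indicator {h<..<R} t"
      using U
    proof eventually_elim
      case (elim t)
      show ?case
      proof (cases "t \<in> {h<..<R}")
        case True
        then have "U = G j t + integral {t..R} (G (Suc j))" using elim h by (auto simp: G_def)
        then have "ennreal \<bar>U\<bar> \<le> ennreal \<bar>G j t\<bar> + ennreal \<bar>integral {t..R} (G (Suc j))\<bar>"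
          by (simp add: ennreal_leI flip: ennreal_plus)
        also have "\<dots> \<le> ennreal \<bar>G j t\<bar> + tail (Suc j) h"
          using True h j tail_mono[of h t "Suc j"] integral_G_bound[of "Suc j" t]
          by (intro add_left_mono) auto
        finally show ?thesis using True by simp
      qed simp
    qed
  qed
  also have "\<dots> = tail j h + tail (Suc j) h * ennreal h"
    unfolding nn_integral_add[OF meas] using h by (subst nn_integral_cmult_indicator) (auto simp: tail_def hR)
  also have "\<dots> \<le> ennreal (M * A h) + ennreal (M * A h) * ennreal h"
    using j h by (intro add_mono mult_right_mono tail_bound) auto
  finally have "ennreal (\<bar>U\<bar> * h) \<le> ennreal (M * A h + M * A h * h)"
    using h M A_pos[of h] by (simp flip: ennreal_plus ennreal_mult)
  then have "\<bar>U\<bar> * h \<le> M * A h + M * A h * h"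
    using h M A_pos[of h] by (subst (asm) ennreal_le_iff) (auto intro!: add_nonneg_nonneg mult_nonneg_nonneg less_imp_le)
  then show ?thesis using R by (simp add: B_def h_def field_simps)
qed

text \<open>This has the form that \<open>tail_integral_step\<close> consumes, with the value at
  \<open>R\<close> absorbed into \<open>B * M\<close>.\<close>

lemma pointwise_bound:
  assumes j: "j < k"
  shows "AE t in lebesgue. t \<in> {0<..<R} \<longrightarrow> ennreal \<bar>G j t\<bar> \<le> ennreal (B * M) + tail (Suc j) t"
proof -
  obtain U where U: "AE t in lebesgue. t \<in> {0<..<R} \<longrightarrow> w j t = U - integral {t..R} (G (Suc j))"
    by (rule weak_deriv_representative[OF R deriv[OF j], of "G (Suc j)"])
      (use set_integrable_G[of "Suc j"] j in \<open>auto simp: G_def intro: set_lebesgue_integral_eq_integral(1)\<close>)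
  from U show ?thesis
  proof eventually_elim
    case (elim t)
    show ?case
    proof
      assume t: "t \<in> {0<..<R}"
      then have "\<bar>G j t\<bar> \<le> B * M + \<bar>integral {t..R} (G (Suc j))\<bar>"
        using elim constant_bound[OF j U] by (auto simp: G_def)
      then have "ennreal \<bar>G j t\<bar> \<le> ennreal (B * M) + ennreal \<bar>integral {t..R} (G (Suc j))\<bar>"
        using B_pos M by (simp add: ennreal_leI flip: ennreal_plus)
      also have "\<dots> \<le> ennreal (B * M) + tail (Suc j) t"
        using t j by (intro add_left_mono integral_G_bound) auto
      finally show "ennreal \<bar>G j t\<bar> \<le> ennreal (B * M) + tail (Suc j) t" .
    qed
  qed
qed

text \<open>Each round trades one derivative for the next at the cost of one more factor
  \<open>s\<close> and a constant. Since \<open>tail 1\<close> carries the weight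
  \<open>s ^ 0\<close>, order \<open>k\<close> is reached with weight
  \<open>s ^ (k - 1)\<close>.\<close>

lemma iterated_tail_bound:
  assumes t: "0 < t" and i: "Suc i \<le> k"
  shows "tail 1 t \<le> ennreal (M * (\<Sum>l<i. B * R ^ Suc l)) +
    (\<integral>\<^sup>+s. indicator {t<..<R} s * (ennreal (s ^ i) * ennreal \<bar>G (Suc i) s\<bar>) \<partial>lebesgue)"
  using i
proof (induction i)
  case 0
  then show ?case by (simp add: tail_def)
next
  case (Suc i)
  let ?K = "\<lambda>i. M * (\<Sum>l<i. B * R ^ Suc l)"
  note [measurable] = G_measurable
  have "tail 1 t \<le> ennreal (?K i) +
      (\<integral>\<^sup>+s. indicator {t<..<R} s * (ennreal (s ^ i) * ennreal \<bar>G (Suc i) s\<bar>) \<partial>lebesgue)"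
    using Suc by simp
  also have "\<dots> \<le> ennreal (?K i) + (ennreal (B * M) * ennreal (R ^ Suc i) +
      (\<integral>\<^sup>+s. indicator {t<..<R} s * (ennreal (s ^ Suc i) * ennreal \<bar>G (Suc (Suc i)) s\<bar>) \<partial>lebesgue))"
    using Suc.prems t pointwise_bound[of "Suc i"]
    by (intro add_left_mono tail_integral_step) (auto simp: tail_def)
  also have "\<dots> = ennreal (?K (Suc i)) +
      (\<integral>\<^sup>+s. indicator {t<..<R} s * (ennreal (s ^ Suc i) * ennreal \<bar>G (Suc (Suc i)) s\<bar>) \<partial>lebesgue)"
  proof -
    have "0 \<le> ?K i" using M B_pos R by (intro mult_nonneg_nonneg sum_nonneg) auto
    moreover have "?K (Suc i) = ?K i + B * M * R ^ Suc i" by (simp add: algebra_simps)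
    ultimately have "ennreal (?K (Suc i)) = ennreal (?K i) + ennreal (B * M) * ennreal (R ^ Suc i)"
      using M B_pos R by (simp add: ennreal_mult)
    then show ?thesis by (simp add: add.assoc)
  qed
  finally show ?case .
qed

text \<open>Hoelder's inequality for the top derivative, in the guise of Young's inequality with optimal scaling;
  because \<^term>\<open>real N = real k * p\<close>, the dual weight is exactly \<^term>\<open>1 / s\<close>.\<close>

lemma weighted_tail_bound:
  assumes t: "0 < t" "t \<le> R"
  shows "(\<integral>\<^sup>+s. indicator {t<..<R} s * (ennreal (s ^ (k - 1)) * ennreal \<bar>G k s\<bar>) \<partial>lebesgue)
    \<le> ennreal (M * (ln (R / t) + 1) powr ((p - 1) / p) * (D / p + (p - 1) / p))"
proof -
  define q where "q = p / (p - 1)"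
  have q: "1 < q" "1 / q = (p - 1) / p" "1 / p + 1 / q = 1"
    using p by (auto simp: q_def field_simps)
  \<comment> \<open>Adding 1 keeps \<open>L\<close> positive at \<open>t = R\<close>, where the
    logarithm vanishes.\<close>
  define L where "L = ln (R / t) + 1"
  have L: "1 \<le> L" using t by (simp add: L_def)
  define E where "E = M * L powr (1 / q)"
  have E: "0 < E" using M L by (simp add: E_def)
  note [measurable] = G_measurable[of k, simplified] ident_measurable_lebesgue
  define c where "c = E / (M powr p * p)"
  define d where "d = E / (L * q)"
  have cd: "0 < c" "0 < d" using E M L p q by (auto simp: c_def d_def)
  have pw: "s ^ (k - 1) * \<bar>G k s\<bar> \<le> c * (\<bar>G k s\<bar> powr p * s ^ (N - 1)) + d * (1 / s)" if s: "0 < s" for s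
  proof -
    \<comment> \<open>Normalised so that \<open>x powr p\<close> has integral at most
      \<open>D\<close> over \<open>{0<..<R}\<close> and \<open>y powr q\<close> at most 1 over
      \<open>{t<..<R}\<close>; \<open>E\<close> is the product of the scales divided out.\<close>
    define x where "x = \<bar>G k s\<bar> * s powr (real (N - 1) / p) / M"
    define y where "y = s powr (- 1 / q) / L powr (1 / q)"
    \<comment> \<open>Here \<open>real N = real k * p\<close> enters: the powers of \<open>s\<close>
      in \<open>x\<close> and \<open>y\<close> combine to exactly
      \<open>s ^ (k - 1)\<close>.\<close>
    have ex: "real (N - 1) / p + - 1 / q = real (k - 1)"
    proof -
      have "real (N - 1) / p + - 1 / q = (real k * p - 1) / p - (p - 1) / p"
        using N Nkp q(2) by (simp add: of_nat_diff)
      also have "\<dots> = real k - 1" using p by (simp add: field_simps)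
      finally show ?thesis using k by (simp add: of_nat_diff)
    qed
    have "E * (x * y) = \<bar>G k s\<bar> * (s powr (real (N - 1) / p) * s powr (- 1 / q))"
      using M L by (simp add: E_def x_def y_def)
    also have "s powr (real (N - 1) / p) * s powr (- 1 / q) = s ^ (k - 1)"
      using s ex by (simp add: powr_add[symmetric] powr_realpow)
    finally have 1: "s ^ (k - 1) * \<bar>G k s\<bar> = E * (x * y)" by (simp add: mult.commute)
    have 2: "x powr p = \<bar>G k s\<bar> powr p * s ^ (N - 1) / M powr p"
      using s p M by (simp add: x_def powr_divide powr_mult powr_powr powr_realpow)
    have 3: "y powr q = 1 / s / L"
      using s q(1) L by (simp add: y_def powr_divide powr_mult powr_powr powr_minus_divide)
    have "E * (x * y) \<le> E * (x powr p / p + y powr q / q)"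
      using s M L E p q by (intro mult_left_mono Youngs_inequality) (auto simp: x_def y_def)
    then show ?thesis unfolding 1 2 3 by (simp add: c_def d_def distrib_left mult_ac)
  qed
  have "(\<integral>\<^sup>+s. indicator {t<..<R} s * (ennreal (s ^ (k - 1)) * ennreal \<bar>G k s\<bar>) \<partial>lebesgue)
    \<le> (\<integral>\<^sup>+s. ennreal c * (indicator {0<..<R} s * ennreal (\<bar>G k s\<bar> powr p * s ^ (N - 1)))
        + ennreal d * (indicator {t<..<R} s * ennreal (1 / s)) \<partial>lebesgue)"
  proof (rule nn_integral_mono)
    fix s :: real
    show "indicator {t<..<R} s * (ennreal (s ^ (k - 1)) * ennreal \<bar>G k s\<bar>)
      \<le> ennreal c * (indicator {0<..<R} s * ennreal (\<bar>G k s\<bar> powr p * s ^ (N - 1)))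
        + ennreal d * (indicator {t<..<R} s * ennreal (1 / s))"
    proof (cases "s \<in> {t<..<R}")
      case True
      then show ?thesis
        using pw[of s] t cd by (simp add: ennreal_leI flip: ennreal_plus ennreal_mult)
    qed simp
  qed
  also have "\<dots> = ennreal c * (\<integral>\<^sup>+s. indicator {0<..<R} s * ennreal (\<bar>G k s\<bar> powr p * s ^ (N - 1)) \<partial>lebesgue)
      + ennreal d * (\<integral>\<^sup>+s. indicator {t<..<R} s * ennreal (1 / s) \<partial>lebesgue)"
    by (subst nn_integral_add) (auto simp: nn_integral_cmult)
  also have "(\<integral>\<^sup>+s. indicator {0<..<R} s * ennreal (\<bar>G k s\<bar> powr p * s ^ (N - 1)) \<partial>lebesgue) =
      (\<integral>\<^sup>+s. indicator {0<..<R} s * ennreal (\<bar>w k s\<bar> powr p * s ^ (N - 1)) \<partial>lebesgue)"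
    by (intro nn_integral_cong) (auto simp: G_def indicator_def)
  also have "(\<integral>\<^sup>+s. indicator {t<..<R} s * ennreal (1 / s) \<partial>lebesgue) = ennreal (ln (R / t))"
    by (rule nn_integral_inverse_Ioo[OF t])
  also have "ennreal c * (\<integral>\<^sup>+s. indicator {0<..<R} s * ennreal (\<bar>w k s\<bar> powr p * s ^ (N - 1)) \<partial>lebesgue)
      + ennreal d * ennreal (ln (R / t)) \<le> ennreal c * ennreal (D * M powr p) + ennreal d * ennreal L"
    by (intro add_mono mult_left_mono energy ennreal_leI) (auto simp: L_def)
  also have "\<dots> = ennreal (c * (D * M powr p) + d * L)"
    using cd D L by (simp flip: ennreal_plus ennreal_mult)
  also have "c * (D * M powr p) + d * L = E * (D / p + 1 / q)"
    using M L p q by (simp add: c_def d_def field_simps)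
  finally show ?thesis by (simp add: E_def q(2) L_def)
qed

text \<open>\<open>constant_bound\<close> controls \<open>U\<close>, and the iteration stopped at
  order \<open>k\<close> followed by \<open>weighted_tail_bound\<close> controls the integral. Since
  the logarithmic factor is at least 1, it absorbs all terms free of \<open>t\<close>.\<close>

lemma representative_bound:
  assumes U: "AE t in lebesgue. t \<in> {0<..<R} \<longrightarrow> w 0 t = U - integral {t..R} (G 1)"
    and t: "t \<in> {0<..R}"
  shows "\<bar>U - integral {t..R} (G 1)\<bar> \<le>
    (B + (\<Sum>l<k-1. B * R ^ Suc l) + (D / p + (p - 1) / p)) * (ln (R / t) powr ((p - 1) / p) + 1) * M"
proof -
  define K where "K = (\<Sum>l<k-1. B * R ^ Suc l)"
  define e where "e = D / p + (p - 1) / p"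
  define a where "a = (p - 1) / p"
  define X where "X = ln (R / t) powr a + 1"
  have K: "0 \<le> K" unfolding K_def using B_pos R by (intro sum_nonneg) auto
  have e: "0 \<le> e" using D p by (simp add: e_def)
  have X: "1 \<le> X" by (simp add: X_def)
  have "ennreal \<bar>integral {t..R} (G 1)\<bar> \<le> tail 1 t"
    using k t by (intro integral_G_bound) auto
  also have "\<dots> \<le> ennreal (M * K) +
      (\<integral>\<^sup>+s. indicator {t<..<R} s * (ennreal (s ^ (k - 1)) * ennreal \<bar>G (Suc (k - 1)) s\<bar>) \<partial>lebesgue)"
    unfolding K_def using t k by (intro iterated_tail_bound) auto
  also have "\<dots> \<le> ennreal (M * K) + ennreal (M * (ln (R / t) + 1) powr a * e)"
    using k t weighted_tail_bound[of t] by (intro add_left_mono) (simp add: a_def e_def)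
  also have "\<dots> = ennreal (M * K + M * (ln (R / t) + 1) powr a * e)"
    using M K e by (simp flip: ennreal_plus)
  finally have "\<bar>integral {t..R} (G 1)\<bar> \<le> M * K + M * (ln (R / t) + 1) powr a * e"
    using M K e by (subst (asm) ennreal_le_iff) auto
  also have "\<dots> \<le> M * K * X + M * X * e"
  proof (intro add_mono mult_right_mono mult_left_mono)
    show "M * K \<le> M * K * X" using mult_left_mono[of 1 X "M * K"] M K X by simp
    show "(ln (R / t) + 1) powr a \<le> X"
      unfolding X_def by (rule powr_add_one_le) (use t p in \<open>auto simp: a_def\<close>)
  qed (use M e in auto)
  finally have "\<bar>integral {t..R} (G 1)\<bar> \<le> (K + e) * X * M" by (simp add: algebra_simps)
  moreover have "\<bar>U\<bar> \<le> B * X * M"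
  proof -
    have "\<bar>U\<bar> \<le> B * M" using k U by (intro constant_bound[of 0]) auto
    also have "B * M * 1 \<le> B * M * X" using B_pos M X by (intro mult_left_mono) auto
    finally show ?thesis by (simp add: mult_ac)
  qed
  ultimately have "\<bar>U - integral {t..R} (G 1)\<bar> \<le> (B + K + e) * X * M"
    by (simp add: algebra_simps)
  then show ?thesis by (simp add: K_def e_def a_def X_def)
qed

end

subsection \<open>Weighted Sobolev spaces\<close>

text \<open>For \<open>j = 0\<close> the function is its own derivative as soon as it is locally
  integrable, which any witness of order 0 entails; for positive \<open>j\<close> this is the
  property of the chosen witness.\<close>

lemma weighted_sobolev_has_weak_deriv:
  assumes "v \<in> weighted_sobolev \<Omega> k p \<omega>" "j \<le> k"
  shows "has_weak_deriv \<Omega> j v (weak_deriv \<Omega> j v)"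
proof (cases "j = 0")
  case True
  obtain w where "has_weak_deriv \<Omega> j v w"
    using assms by (auto simp: weighted_sobolev_def)
  then show ?thesis using True by (simp add: has_weak_deriv_def weak_deriv_def)
next
  case False
  have "\<exists>w. has_weak_deriv \<Omega> j v w" using assms by (auto simp: weighted_sobolev_def)
  then show ?thesis using False unfolding weak_deriv_def by (simp add: someI_ex)
qed

lemma weighted_sobolev_energy_bound:
  assumes v: "v \<in> weighted_sobolev \<Omega> k p \<omega>" and j: "j \<le> k" and p: "0 < p"
    and \<omega>: "\<And>t. t \<in> \<Omega> \<Longrightarrow> 0 \<le> \<omega> t" and M: "weighted_sobolev_norm \<Omega> k p \<omega> v \<le> M"
  shows "(\<integral>\<^sup>+t. indicator \<Omega> t * ennreal (\<bar>weak_deriv \<Omega> j v t\<bar> powr p * \<omega> t) \<partial>lebesgue) \<le> ennreal (M powr p)"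
proof -
  let ?I = "\<lambda>j. LINT t:\<Omega>|lebesgue. \<bar>weak_deriv \<Omega> j v t\<bar> powr p * \<omega> t"
  have I0: "0 \<le> ?I j" for j
    unfolding set_lebesgue_integral_def using \<omega> by (intro integral_nonneg_AE AE_I2) (auto simp: indicator_def)
  have "(\<integral>\<^sup>+t. indicator \<Omega> t * ennreal (\<bar>weak_deriv \<Omega> j v t\<bar> powr p * \<omega> t) \<partial>lebesgue)
      = (\<integral>\<^sup>+t. ennreal (indicator \<Omega> t *\<^sub>R (\<bar>weak_deriv \<Omega> j v t\<bar> powr p * \<omega> t)) \<partial>lebesgue)"
    by (intro nn_integral_cong) (auto simp: indicator_def)
  \<comment> \<open>Membership in the space supplies integrability, so the Bochner integral is the
    true value and not the default 0.\<close>
  also have "\<dots> = ennreal (?I j)"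
    unfolding set_lebesgue_integral_def
    using v j \<omega> by (intro nn_integral_eq_integral AE_I2) (auto simp: weighted_sobolev_def set_integrable_def indicator_def)
  also have "?I j \<le> (\<Sum>j=0..k. ?I j)"
    using I0 j by (intro member_le_sum) auto
  also have "\<dots> = weighted_sobolev_norm \<Omega> k p \<omega> v powr p"
    using p I0 by (simp add: weighted_sobolev_norm_def powr_powr sum_nonneg)
  also have "\<dots> \<le> M powr p"
    using M p by (intro powr_mono2) (auto simp: weighted_sobolev_norm_def)
  finally show ?thesis by (simp add: ennreal_leI)
qed

theorem proposition5p3:
  fixes R p :: real and N k :: nat and \<phi> :: "real \<Rightarrow> real"
  assumes "0 < R" and "2 \<le> N" and "1 \<le> k"
    and "smooth_on {0..<R} \<phi>"
    and "\<forall>r\<in>{0..<R}. 0 \<le> \<phi> r"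
    and "\<forall>r\<in>{0<..<R}. 0 < \<phi> r"
    and "nth_deriv_within 1 \<phi> {0..<R} 0 = 1"
    and "\<forall>i. even i \<longrightarrow> nth_deriv_within i \<phi> {0..<R} 0 = 0"
    and "0 < Liminf (at_left R) (\<lambda>r. ereal (\<phi> r))"
    and "Limsup (at_left R) (\<lambda>r. ereal (\<phi> r)) < \<infinity>"
    and "real N = real k * p" and "1 < p"
  shows "\<exists>C>0. \<forall>v\<in>weighted_sobolev {0<..<R} k p (\<lambda>t. \<phi> t ^ (N - 1)).
    \<exists>u. continuous_representative R v u \<and>
      (\<forall>t\<in>{0<..R}. \<bar>u t\<bar> \<le> C * (ln (R / t) powr ((p - 1) / p) + 1) *
         weighted_sobolev_norm {0<..<R} k p (\<lambda>t. \<phi> t ^ (N - 1)) v)"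
proof -
  let ?\<Omega> = "{0<..<R}" and ?\<omega> = "\<lambda>t. \<phi> t ^ (N - 1)"
  have "\<phi> 0 = 0" using assms(8) by (auto dest: spec[of _ 0])
  then obtain c where c: "0 < c" "\<And>t. t \<in> ?\<Omega> \<Longrightarrow> c * t \<le> \<phi> t"
    using smooth_weight_lower_bound assms by metis
  define D where "D = 1 / c ^ (N - 1)"
  have D: "0 < D" using c by (simp add: D_def)
  \<comment> \<open>Outside the locale \<open>B\<close> takes only \<open>R\<close>,
    \<open>D\<close> and \<open>N\<close> as arguments, so \<open>C\<close> is fixed before
    \<open>v\<close>.\<close>
  define B where "B = weak_deriv_chain.B R D N"
  define C where "C = B + (\<Sum>l<k-1. B * R ^ Suc l) + (D / p + (p - 1) / p)"
  have chain: "weak_deriv_chain R p D M N k (\<lambda>j. weak_deriv ?\<Omega> j v)"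
    if v: "v \<in> weighted_sobolev ?\<Omega> k p ?\<omega>" and M: "0 < M" "weighted_sobolev_norm ?\<Omega> k p ?\<omega> v \<le> M" for v M
  proof
    fix j assume j: "j \<le> k"
    have "(\<integral>\<^sup>+t. indicator ?\<Omega> t * ennreal (\<bar>weak_deriv ?\<Omega> j v t\<bar> powr p * t ^ (N - 1)) \<partial>lebesgue)
      \<le> (\<integral>\<^sup>+t. ennreal D * (indicator ?\<Omega> t * ennreal (\<bar>weak_deriv ?\<Omega> j v t\<bar> powr p * ?\<omega> t)) \<partial>lebesgue)"
    proof (intro nn_integral_mono)
      fix t
      show "indicator ?\<Omega> t * ennreal (\<bar>weak_deriv ?\<Omega> j v t\<bar> powr p * t ^ (N - 1))
        \<le> ennreal D * (indicator ?\<Omega> t * ennreal (\<bar>weak_deriv ?\<Omega> j v t\<bar> powr p * ?\<omega> t))"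
      proof (cases "t \<in> ?\<Omega>")
        case t: True
        have "(c * t) ^ (N - 1) \<le> ?\<omega> t" using c t by (intro power_mono) auto
        then have "t ^ (N - 1) \<le> D * ?\<omega> t"
          using c by (simp add: D_def power_mult_distrib field_simps)
        then have "\<bar>weak_deriv ?\<Omega> j v t\<bar> powr p * t ^ (N - 1) \<le> \<bar>weak_deriv ?\<Omega> j v t\<bar> powr p * (D * ?\<omega> t)"
          by (intro mult_left_mono) auto
        then show ?thesis
          using t D assms(5) by (simp add: ennreal_leI mult_ac flip: ennreal_mult)
      qed simp
    qed
    also have "\<dots> = ennreal D * (\<integral>\<^sup>+t. indicator ?\<Omega> t * ennreal (\<bar>weak_deriv ?\<Omega> j v t\<bar> powr p * ?\<omega> t) \<partial>lebesgue)"
    proof (rule nn_integral_cmult)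
      have "(\<lambda>t. indicator ?\<Omega> t *\<^sub>R (\<bar>weak_deriv ?\<Omega> j v t\<bar> powr p * ?\<omega> t)) \<in> borel_measurable lebesgue"
        using v j by (intro borel_measurable_integrable) (auto simp: weighted_sobolev_def set_integrable_def)
      then have "(\<lambda>t. ennreal (indicator ?\<Omega> t *\<^sub>R (\<bar>weak_deriv ?\<Omega> j v t\<bar> powr p * ?\<omega> t))) \<in> borel_measurable lebesgue"
        by simp
      also have "(\<lambda>t. ennreal (indicator ?\<Omega> t *\<^sub>R (\<bar>weak_deriv ?\<Omega> j v t\<bar> powr p * ?\<omega> t))) =
          (\<lambda>t. indicator ?\<Omega> t * ennreal (\<bar>weak_deriv ?\<Omega> j v t\<bar> powr p * ?\<omega> t))"
        by (auto simp: fun_eq_iff indicator_def)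
      finally show "(\<lambda>t. indicator ?\<Omega> t * ennreal (\<bar>weak_deriv ?\<Omega> j v t\<bar> powr p * ?\<omega> t)) \<in> borel_measurable lebesgue" .
    qed
    also have "\<dots> \<le> ennreal D * ennreal (M powr p)"
      using assms(5,12) by (intro mult_left_mono weighted_sobolev_energy_bound[OF v j _ _ M(2)]) auto
    also have "\<dots> = ennreal (D * M powr p)" using D by (simp add: ennreal_mult)
    finally show "(\<integral>\<^sup>+t. indicator ?\<Omega> t * ennreal (\<bar>weak_deriv ?\<Omega> j v t\<bar> powr p * t ^ (N - 1)) \<partial>lebesgue)
      \<le> ennreal (D * M powr p)" .
  next
    fix j assume "j < k"
    then show "has_weak_deriv ?\<Omega> 1 (weak_deriv ?\<Omega> j v) (weak_deriv ?\<Omega> (Suc j) v)"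
      using weighted_sobolev_has_weak_deriv[OF v] by (intro has_weak_deriv_step[of _ j v]) auto
  qed (use assms D M in auto)
  show ?thesis
  proof (intro exI[of _ C] conjI ballI)
    \<comment> \<open>Positivity of \<open>B\<close> is a fact of the locale; the chain of zero
      functions provides an instance before any \<open>v\<close> is chosen.\<close>
    have "weak_deriv_chain R p D 1 N k (\<lambda>j t. 0)"
    proof
      show "has_weak_deriv ?\<Omega> 1 (\<lambda>t. 0) (\<lambda>t. 0)" for j :: nat
        by (simp add: has_weak_deriv_def locally_integrable_on_def)
    qed (use assms D in auto)
    then have "0 < B" unfolding B_def by (rule weak_deriv_chain.B_pos)
    then show "0 < C"
      using D assms unfolding C_def by (intro add_pos_nonneg sum_nonneg add_nonneg_nonneg) auto
  next
    fix v assume v: "v \<in> weighted_sobolev ?\<Omega> k p ?\<omega>"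
    let ?n = "weighted_sobolev_norm ?\<Omega> k p ?\<omega> v"
    have n: "0 \<le> ?n" by (simp add: weighted_sobolev_norm_def)
    define G where "G = weak_deriv_chain.G R (\<lambda>j. weak_deriv ?\<Omega> j v) 1"
    \<comment> \<open>The norm may be 0 while the locale demands a positive bound, hence the added
      1. \<open>G\<close> does not depend on that bound.\<close>
    interpret W: weak_deriv_chain R p D "?n + 1" N k "\<lambda>j. weak_deriv ?\<Omega> j v"
      using v n by (intro chain) auto
    have int: "G integrable_on {s..R}" if "0 < s" for s
      using that assms(3) W.set_integrable_G[of 1 s] by (auto simp: G_def intro: set_lebesgue_integral_eq_integral(1))
    obtain U where U: "AE t in lebesgue. t \<in> ?\<Omega> \<longrightarrow> weak_deriv ?\<Omega> 0 v t = U - integral {t..R} G"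
      by (rule weak_deriv_representative[OF assms(1) W.deriv[of 0], of G])
        (use int assms(3) in \<open>auto simp: G_def W.G_def\<close>)
    define u where "u t = U - integral {t..R} G" for t
    have "continuous_on {0<..R} u"
      unfolding continuous_on_eq_continuous_within
    proof
      fix x assume x: "x \<in> {0<..R}"
      have "continuous_on {x/2..R} u"
        unfolding u_def using x by (intro continuous_intros indefinite_integral_continuous_1' int) auto
      then have "continuous (at x within {x/2..R}) u"
        using x by (simp add: continuous_on_eq_continuous_within)
      \<comment> \<open>Near \<open>x\<close> the two sets agree, and \<open>G\<close> is integrable
        on the compact one.\<close>
      moreover have "at x within {0<..R} = at x within {x/2..R}"
        by (rule at_within_nhd[of _ "{x/2<..}"]) (use x in auto)
      ultimately show "continuous (at x within {0<..R}) u" by simp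
    qed
    then have "continuous_representative R v u"
      using U unfolding continuous_representative_def u_def by (auto simp: weak_deriv_def elim!: AE_mp)
    moreover have "\<bar>u t\<bar> \<le> C * (ln (R / t) powr ((p - 1) / p) + 1) * ?n" if t: "t \<in> {0<..R}" for t
    proof (rule field_le_epsilon)
      fix e :: real assume "0 < e"
      define E where "E = C * (ln (R / t) powr ((p - 1) / p) + 1)"
      \<comment> \<open>A bound just above the norm, valid even for norm 0; the denominator keeps
        the excess \<open>E * (M - ?n)\<close> at most \<open>e\<close>. The same \<open>U\<close>
        serves every such \<open>M\<close>.\<close>
      define M where "M = ?n + e / (\<bar>E\<bar> + 1)"
      have M: "?n < M" using \<open>0 < e\<close> by (simp add: M_def)
      interpret V: weak_deriv_chain R p D M N k "\<lambda>j. weak_deriv ?\<Omega> j v"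
        using v n M by (intro chain) auto
      have "\<bar>u t\<bar> \<le> E * M"
        using V.representative_bound[OF U[unfolded G_def] t] by (simp add: u_def G_def E_def C_def B_def)
      also have "\<dots> \<le> E * ?n + e"
      proof -
        have "E * (e / (\<bar>E\<bar> + 1)) \<le> (\<bar>E\<bar> + 1) * (e / (\<bar>E\<bar> + 1))"
          using \<open>0 < e\<close> by (intro mult_right_mono) auto
        then show ?thesis by (simp add: M_def distrib_left)
      qed
      finally show "\<bar>u t\<bar> \<le> C * (ln (R / t) powr ((p - 1) / p) + 1) * ?n + e" by (simp add: E_def)
    qed
    ultimately show "\<exists>u. continuous_representative R v u \<and>
      (\<forall>t\<in>{0<..R}. \<bar>u t\<bar> \<le> C * (ln (R / t) powr ((p - 1) / p) + 1) * ?n)" by blast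
  qed
qed

end
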